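(* Let $d\ge 4$ and let $d_1,d_2$ be integers with $1\le d_1,d_2\le d$, $d_1+d_2>d$ and $(d,d_1,d_2)\neq(4,3,2)$. Then the $M_d(d_1,d_2)$-random walk $(S_n)_{n\ge 0}$ on $\mathbb{Z}^d$ is transient, that is, almost surely every site $x\in\mathbb{Z}^d$ is visited by $(S_n)_{n\ge 0}$ only finitely many times.
   Context: Let $d\ge 2$ and $d_1,d_2\in\{1,\dots,d\}$, and let $e_1,\dots,e_d$ be the canonical basis vectors of $\mathbb{Z}^d$. The $M_d(d_1,d_2)$-random walk (balanced excited random walk) is the discrete-time, $\mathbb{Z}^d$-valued stochastic process $(S_n)_{n\ge 0}$ with $S_0=0$ whose law is determined as follows. Let $\mathcal{F}_n=\sigma(S_0,\dots,S_n)$. (i) On the event that $S_n\neq S_j$ for all $0\le j<n$ (the walk is at a site visited for the first time at time $n$; in particular this holds for $n=0$), for every $1\le i\le d_1$ and each sign, $$\mathbb{P}[S_{n+1}-S_n=\pm e_i\mid \mathcal{F}_n]=\frac{1}{2d_1}.$$ That is, the step is a simple random walk step in the first $d_1$ coordinates. (ii) On the event that $S_n=S_j$ for some $0\le j<n$ (the site was already visited before time $n$), for every $d-d_2+1\le i\le d$ and each sign, $$\mathbb{P}[S_{n+1}-S_n=\pm e_i\mid \mathcal{F}_n]=\frac{1}{2d_2}.$$ That is, the step is a simple random walk step in the last $d_2$ coordinates. The walk is called transient if, almost surely, every site of $\mathbb{Z}^d$ is visited only finitely many times. *)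

theory Defs
  imports "HOL-Probability.Probability"
begin

text \<open>Points of \<open>\<int>\<^sup>d\<close> are functions on the natural numbers with coordinates indexed
  by \<open>1, \<dots>, d\<close> and value \<open>0\<close> at every other index. The set is countable and carries the
  discrete sigma-algebra.\<close>

definition lattice :: "nat \<Rightarrow> (nat \<Rightarrow> int) set" where
  "lattice d = {x. \<forall>i. i \<notin> {1..d} \<longrightarrow> x i = 0}"

definition basis_vec :: "nat \<Rightarrow> nat \<Rightarrow> int" where
  "basis_vec i = (\<lambda>k. if k = i then 1 else 0)"

definition past :: "'a measure \<Rightarrow> nat \<Rightarrow> (nat \<Rightarrow> 'a \<Rightarrow> nat \<Rightarrow> int) \<Rightarrow> nat \<Rightarrow> 'a measure" where
  "past M d S n = sigma (space M) {S j -` A \<inter> space M | j A. j \<le> n \<and> A \<subseteq> lattice d}"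

text \<open>The event that the increment between times \<open>n\<close> and \<open>n + 1\<close> is \<open>s\<close> times the \<open>i\<close>-th
  basis vector; the sign \<open>s\<close> is \<open>1\<close> or \<open>-1\<close>.\<close>

definition step_event ::
    "'a measure \<Rightarrow> (nat \<Rightarrow> 'a \<Rightarrow> nat \<Rightarrow> int) \<Rightarrow> nat \<Rightarrow> nat \<Rightarrow> int \<Rightarrow> 'a set" where
  "step_event M S n i s =
     {\<omega> \<in> space M. (\<lambda>k. S (Suc n) \<omega> k - S n \<omega> k) = (\<lambda>k. s * basis_vec i k)}"

text \<open>A conditional probability given a sub-sigma-algebra is the conditional expectation of the
  indicator function; as such it is determined only almost surely. The index set
  \<open>{d - d2 + 1..d}\<close> is not affected by truncated subtraction, as \<open>d2 \<le> d\<close>.\<close>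

locale balanced_excited_walk = prob_space M for M :: "'a measure" +
  fixes d d1 d2 :: nat and S :: "nat \<Rightarrow> 'a \<Rightarrow> nat \<Rightarrow> int"
  assumes d_ge_2: "2 \<le> d"
    and d1_range: "d1 \<in> {1..d}"
    and d2_range: "d2 \<in> {1..d}"
    and S_measurable: "\<And>n. S n \<in> measurable M (count_space (lattice d))"
    and S_0: "AE \<omega> in M. S 0 \<omega> = (\<lambda>_. 0)"
    and fresh_step: "\<And>n i s. i \<in> {1..d1} \<Longrightarrow> s \<in> {1, -1} \<Longrightarrow>
      AE \<omega> in M. (\<forall>j<n. S n \<omega> \<noteq> S j \<omega>) \<longrightarrow>
        real_cond_exp M (past M d S n) (indicator (step_event M S n i s)) \<omega> = 1 / (2 * real d1)"
    and revisit_step: "\<And>n i s. i \<in> {d - d2 + 1..d} \<Longrightarrow> s \<in> {1, -1} \<Longrightarrow>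
      AE \<omega> in M. (\<exists>j<n. S n \<omega> = S j \<omega>) \<longrightarrow>
        real_cond_exp M (past M d S n) (indicator (step_event M S n i s)) \<omega> = 1 / (2 * real d2)"
begin

lemma subalgebra_past: "subalgebra M (past M d S n)"
proof -
  have "{S j -` A \<inter> space M | j A. j \<le> n \<and> A \<subseteq> lattice d} \<subseteq> sets M"
    using measurable_sets[OF S_measurable] by auto
  then show ?thesis
    unfolding subalgebra_def past_def
    by (auto simp: space_measure_of_conv sets_measure_of_conv
        intro: sets.sigma_sets_subset[THEN subsetD] split: if_splits)
qed

end

definition transient :: "'a measure \<Rightarrow> nat \<Rightarrow> (nat \<Rightarrow> 'a \<Rightarrow> nat \<Rightarrow> int) \<Rightarrow> bool" where
  "transient M d S \<longleftrightarrow> (AE \<omega> in M. \<forall>x\<in>lattice d. finite {n. S n \<omega> = x})"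

end

theory Submission
  imports Defs "HOL-Real_Asymp.Real_Asymp"
begin

text \<open>Every estimate uses a function of the past of the walk that decreases on average in each step.

If \<open>d2 \<ge> 3\<close>, take a small negative power of a weighted squared norm. Its drift is strictly
negative at revisited sites. At fresh sites it can be slightly positive, but only for \<open>d1 \<le> 2\<close>,
and then a fresh site is so often left backwards that the revisited sites compensate. The drift is
summable, so each site has a finite expected number of visits.

If \<open>d - d2 \<ge> 3\<close>, the first \<open>d - d2\<close> coordinates perform a simple random walk that moves only at
fresh sites, and the same function shows that this projection is at a given point at only finitely
many fresh times. A site visited infinitely often would thus trap the walk in a finite set, whereas
coordinate \<open>d1\<close>, which moves with probability at least \<open>1 / d\<close> in every step, is unbounded.

The remaining case is \<open>(d, d1, d2) = (4, 4, 2)\<close>, an interleaving of two planar simple random walks,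
treated as in the work of Benjamini, Kozma and Schapira. The second one visits no point more than of
order \<open>log\<^sup>2 n\<close> times by time \<open>n\<close>, so there are at least of order \<open>n / log\<^sup>2 n\<close> fresh times, and both
walks have made that many steps. A planar walk hits a given point between its steps \<open>n / log\<^sup>2 n\<close>
and \<open>n\<close> with probability of order \<open>log (log n) / log n\<close>; for the second walk even \<open>n / 4\<close> steps are
guaranteed. The product of the two probabilities is summable along \<open>n = 2\<^sup>k\<close>.\<close>

section \<open>Histories of the walk\<close>

definition move :: "(nat \<Rightarrow> int) \<Rightarrow> nat \<Rightarrow> int \<Rightarrow> nat \<Rightarrow> int" where
  "move x i s = (\<lambda>k. x k + s * basis_vec i k)"

lemma move_apply: "move x i s k = (if k = i then x k + s else x k)"
  by (simp add: move_def basis_vec_def)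

lemma move_same [simp]: "move x i s i = x i + s"
  and move_other [simp]: "k \<noteq> i \<Longrightarrow> move x i s k = x k"
  by (simp_all add: move_apply)

lemma move_eq_iff: "move x i s = move x j t \<longleftrightarrow> i = j \<and> s = t \<or> s = 0 \<and> t = 0"
proof
  assume eq: "move x i s = move x j t"
  show "i = j \<and> s = t \<or> s = 0 \<and> t = 0"
    using fun_cong[OF eq, of i] fun_cong[OF eq, of j] by (auto simp: move_apply split: if_splits)
qed (auto simp: move_apply)

text \<open>Histories are lists in reverse chronological order: the current site is the head.\<close>

definition fresh :: "'p list \<Rightarrow> bool" where
  "fresh h \<longleftrightarrow> hd h \<notin> set (tl h)"

locale excited_params =
  fixes d d1 d2 :: nat
  assumes d1_pos: "1 \<le> d1" and d1_le: "d1 \<le> d"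
    and d2_pos: "1 \<le> d2" and d2_le: "d2 \<le> d"
begin

definition dirs :: "(nat \<Rightarrow> int) list \<Rightarrow> nat set" where
  "dirs h = (if fresh h then {1..d1} else {d - d2 + 1..d})"

lemma finite_dirs [simp, intro]: "finite (dirs h)"
  by (simp add: dirs_def)

lemma dirs_nonempty [simp]: "dirs h \<noteq> {}"
  using d1_pos d2_pos d2_le by (auto simp: dirs_def)

lemma card_dirs: "card (dirs h) = (if fresh h then d1 else d2)"
  using d2_le by (simp add: dirs_def)

lemma card_dirs_pos: "0 < card (dirs h)"
  by (simp add: card_gt_0_iff)

lemma dirs_subset: "dirs h \<subseteq> {1..d}"
  using d1_le by (auto simp: dirs_def)

text \<open>The transition operator of the Markov chain of histories: the conditional mean of
  \<open>\<Phi>\<close> one step later, given that the history is now \<open>h\<close>.\<close>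

definition avg :: "((nat \<Rightarrow> int) list \<Rightarrow> real) \<Rightarrow> (nat \<Rightarrow> int) list \<Rightarrow> real" where
  "avg \<Phi> h =
     (\<Sum>i\<in>dirs h. \<Phi> (move (hd h) i 1 # h) + \<Phi> (move (hd h) i (- 1) # h)) / (2 * card (dirs h))"

text \<open>Remembering the whole history makes the walk Markovian, and the finite support makes
  every functional integrable.\<close>

primrec walk :: "nat \<Rightarrow> (nat \<Rightarrow> int) list pmf" where
  "walk 0 = return_pmf [\<lambda>_. 0]"
| "walk (Suc n) = bind_pmf (walk n)
     (\<lambda>h. map_pmf (\<lambda>(i, s). move (hd h) i s # h) (pmf_of_set (dirs h \<times> {1, - 1})))"

lemma set_walk_Suc:
  "set_pmf (walk (Suc n)) =
     (\<Union>h\<in>set_pmf (walk n). (\<lambda>(i, s). move (hd h) i s # h) ` (dirs h \<times> {1, - 1}))"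
  by (simp add: set_pmf_of_set)

lemma walk_SucE:
  assumes "h' \<in> set_pmf (walk (Suc n))"
  obtains h i s where "h \<in> set_pmf (walk n)" "i \<in> dirs h" "s \<in> {1, - 1}" "h' = move (hd h) i s # h"
proof -
  obtain h p where "h \<in> set_pmf (walk n)" and p: "p \<in> dirs h \<times> {1, - 1}"
    and "h' = (case p of (i, s) \<Rightarrow> move (hd h) i s # h)"
    using assms unfolding set_walk_Suc by (elim UN_E imageE)
  then show thesis
    using that[of h "fst p" "snd p"] by (auto simp: case_prod_unfold)
qed

lemma finite_walk [simp, intro]: "finite (set_pmf (walk n))"
proof (induction n)
  case (Suc n)
  show ?case
    unfolding set_walk_Suc by (intro finite_UN_I Suc) auto
qed simp

lemma length_walk: "h \<in> set_pmf (walk n) \<Longrightarrow> length h = Suc n"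
proof (induction n arbitrary: h)
  case (Suc n)
  from Suc.prems show ?case
    by (rule walk_SucE) (simp add: Suc.IH)
qed simp

lemma walk_nonempty: "h \<in> set_pmf (walk n) \<Longrightarrow> h \<noteq> []"
  using length_walk by fastforce

abbreviation expect :: "nat \<Rightarrow> ((nat \<Rightarrow> int) list \<Rightarrow> real) \<Rightarrow> real" where
  "expect n \<Phi> \<equiv> measure_pmf.expectation (walk n) \<Phi>"

lemma expect_Suc: "expect (Suc n) \<Phi> = expect n (avg \<Phi>)"
proof -
  have step: "measure_pmf.expectation
      (map_pmf (\<lambda>(i, s). move (hd h) i s # h) (pmf_of_set (dirs h \<times> {1, - 1}))) \<Phi> = avg \<Phi> h"
    for h
  proof -
    have "(\<Sum>x\<in>dirs h \<times> {1, - 1}. \<Phi> (case x of (i, s) \<Rightarrow> move (hd h) i s # h))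
        = (\<Sum>i\<in>dirs h. \<Sum>s\<in>{1, - 1}. \<Phi> (move (hd h) i s # h))"
      unfolding sum.cartesian_product by (intro sum.cong) auto
    then show ?thesis
      by (simp add: integral_pmf_of_set avg_def card_cartesian_product mult.commute)
  qed
  have "expect (Suc n) \<Phi> = (\<Sum>h\<in>set_pmf (walk n). pmf (walk n) h *\<^sub>R avg \<Phi> h)"
    unfolding walk.simps
    by (subst pmf_expectation_bind[of "set_pmf (walk n)"]) (auto simp: set_pmf_of_set simp flip: step)
  also have "\<dots> = expect n (avg \<Phi>)"
    by (subst integral_measure_pmf[of "set_pmf (walk n)"]) auto
  finally show ?thesis .
qed

lemma expect_mono:
  assumes "\<And>h. h \<in> set_pmf (walk n) \<Longrightarrow> \<Phi> h \<le> \<Psi> h"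
  shows "expect n \<Phi> \<le> expect n \<Psi>"
  by (intro integral_mono_AE integrable_measure_pmf_finite AE_pmfI assms) auto

lemma expect_nonneg:
  assumes "\<And>h. h \<in> set_pmf (walk n) \<Longrightarrow> 0 \<le> \<Phi> h"
  shows "0 \<le> expect n \<Phi>"
  by (intro integral_nonneg_AE AE_pmfI assms)

lemma sum_expect_le:
  assumes drift: "\<And>n h. h \<in> set_pmf (walk n) \<Longrightarrow> avg \<Phi> h + g h \<le> \<Phi> h"
    and nonneg: "\<And>n h. h \<in> set_pmf (walk n) \<Longrightarrow> 0 \<le> \<Phi> h"
  shows "(\<Sum>j<n. expect j g) \<le> \<Phi> [\<lambda>_. 0]"
proof -
  have "(\<Sum>j<n. expect j g) + expect n \<Phi> \<le> \<Phi> [\<lambda>_. 0]"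
  proof (induction n)
    case (Suc n)
    have "expect n (avg \<Phi>) + expect n g = expect n (\<lambda>h. avg \<Phi> h + g h)"
      by (intro Bochner_Integration.integral_add[symmetric] integrable_measure_pmf_finite) auto
    also have "\<dots> \<le> expect n \<Phi>"
      by (intro expect_mono drift)
    finally have "expect (Suc n) \<Phi> + expect n g \<le> expect n \<Phi>"
      by (simp only: expect_Suc)
    then show ?case
      using Suc by (simp del: walk.simps)
  qed simp
  moreover have "0 \<le> expect n \<Phi>"
    by (intro expect_nonneg nonneg)
  ultimately show ?thesis
    by linarith
qed

lemma expect_le_initial:
  assumes step: "\<And>m h. m < n \<Longrightarrow> h \<in> set_pmf (walk m) \<Longrightarrow> avg \<Phi> h \<le> \<Phi> h"
  shows "expect n \<Phi> \<le> \<Phi> [\<lambda>_. 0]"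
  using step
proof (induction n)
  case (Suc n)
  have "expect (Suc n) \<Phi> = expect n (avg \<Phi>)"
    by (rule expect_Suc)
  also have "\<dots> \<le> expect n \<Phi>"
    by (intro expect_mono Suc.prems) auto
  also have "\<dots> \<le> \<Phi> [\<lambda>_. 0]"
    by (intro Suc.IH Suc.prems) auto
  finally show ?case .
qed simp

text \<open>Markov's inequality, for an event on which \<open>\<Phi>\<close> is at least
  \<open>c\<close>.\<close>

lemma prob_le_expect:
  assumes "\<And>h. h \<in> set_pmf (walk n) \<Longrightarrow> 0 \<le> \<Phi> h"
    and "\<And>h. h \<in> set_pmf (walk n) \<Longrightarrow> P h \<Longrightarrow> c \<le> \<Phi> h"
  shows "c * measure (walk n) {h. P h} \<le> expect n \<Phi>"
proof -
  have "c * measure (walk n) {h. P h} = expect n (\<lambda>h. c * indicator {h. P h} h)"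
    by simp
  also have "\<dots> \<le> expect n \<Phi>"
    using assms by (intro expect_mono) (auto simp: indicator_def)
  finally show ?thesis .
qed

primrec occurred :: "((nat \<Rightarrow> int) list \<Rightarrow> bool) \<Rightarrow> (nat \<Rightarrow> int) list \<Rightarrow> bool" where
  "occurred E [] = False"
| "occurred E (x # h) = (E (x # h) \<or> occurred E h)"

text \<open>The supermartingale is stopped, at the value \<open>1\<close>, when \<open>E\<close> first occurs.\<close>

lemma maximal_inequality:
  assumes step: "\<And>m h. m < n \<Longrightarrow> h \<in> set_pmf (walk m) \<Longrightarrow> avg \<Phi> h \<le> \<Phi> h"
    and nonneg: "\<And>m h. m \<le> n \<Longrightarrow> h \<in> set_pmf (walk m) \<Longrightarrow> 0 \<le> \<Phi> h"
    and ge1: "\<And>m h. m \<le> n \<Longrightarrow> h \<in> set_pmf (walk m) \<Longrightarrow> E h \<Longrightarrow> 1 \<le> \<Phi> h"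
  shows "measure (walk n) {h. occurred E h} \<le> \<Phi> [\<lambda>_. 0]"
proof -
  define \<Psi> where "\<Psi> h = (if occurred E h then 1 else \<Phi> h)" for h
  have "avg \<Psi> h \<le> \<Psi> h" if m: "m < n" and h: "h \<in> set_pmf (walk m)" for m h
  proof (cases "occurred E h")
    case True
    then have "avg \<Psi> h = 1"
      using card_dirs_pos[of h] by (simp add: avg_def \<Psi>_def)
    then show ?thesis
      using True by (simp add: \<Psi>_def)
  next
    case False
    have "\<Psi> (move (hd h) i s # h) \<le> \<Phi> (move (hd h) i s # h)" if "i \<in> dirs h" "s \<in> {1, - 1}" for i s
    proof -
      have "move (hd h) i s # h \<in> set_pmf (walk (Suc m))"
        unfolding set_walk_Suc using that h by force
      then show ?thesis
        using ge1[of "Suc m"] m False by (auto simp: \<Psi>_def simp del: walk.simps)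
    qed
    then have "avg \<Psi> h \<le> avg \<Phi> h"
      unfolding avg_def by (intro divide_right_mono sum_mono add_mono) auto
    then show ?thesis
      using step[OF m h] False by (simp add: \<Psi>_def)
  qed
  then have "expect n \<Psi> \<le> \<Psi> [\<lambda>_. 0]"
    by (intro expect_le_initial) auto
  also have "\<dots> \<le> \<Phi> [\<lambda>_. 0]"
    using ge1[of 0 "[\<lambda>_. 0]"] by (auto simp: \<Psi>_def)
  finally have "expect n \<Psi> \<le> \<Phi> [\<lambda>_. 0]" .
  moreover have "1 * measure (walk n) {h. occurred E h} \<le> expect n \<Psi>"
    by (rule prob_le_expect) (use nonneg[of n] in \<open>auto simp: \<Psi>_def\<close>)
  ultimately show ?thesis
    by simp
qed

end

section \<open>The law of the histories of a given process\<close>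

primrec hist :: "(nat \<Rightarrow> 'a \<Rightarrow> 'p) \<Rightarrow> nat \<Rightarrow> 'a \<Rightarrow> 'p list" where
  "hist S 0 \<omega> = [S 0 \<omega>]"
| "hist S (Suc n) \<omega> = S (Suc n) \<omega> # hist S n \<omega>"

lemma hd_hist [simp]: "hd (hist S n \<omega>) = S n \<omega>"
  by (cases n) auto

lemma set_hist: "set (hist S n \<omega>) = (\<lambda>j. S j \<omega>) ` {..n}"
  by (induction n) (auto simp: atMost_Suc)

lemma fresh_hist: "fresh (hist S n \<omega>) \<longleftrightarrow> (\<forall>j<n. S n \<omega> \<noteq> S j \<omega>)"
  by (cases n) (auto simp: fresh_def set_hist less_Suc_eq_le)

lemma countable_lattice: "countable (lattice d)"
proof (rule countableI')
  show "inj_on (\<lambda>x. to_nat (map x [1..<d + 1])) (lattice d)"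
  proof (rule inj_onI)
    fix x y assume xy: "x \<in> lattice d" "y \<in> lattice d"
      and "to_nat (map x [1..<d + 1]) = to_nat (map y [1..<d + 1])"
    then have "\<forall>i\<in>{1..d}. x i = y i"
      by auto
    with xy show "x = y"
      by (force simp: lattice_def)
  qed
qed

context balanced_excited_walk
begin

sublocale excited_params d d1 d2
  using d1_range d2_range by unfold_locales auto

lemma hist_measurable: "hist S n \<in> measurable M (count_space (lists (lattice d)))"
proof (induction n)
  case 0
  show ?case
    unfolding hist.simps by (rule measurable_compose[OF S_measurable]) auto
next
  case (Suc n)
  have cnt: "countable (lists (lattice d))"
    by (intro countable_lists countable_lattice)
  have eq: "f \<in> measurable M (count_space (lists (lattice d))) \<longleftrightarrow>
      f \<in> space M \<rightarrow> lists (lattice d) \<and> (\<forall>a\<in>lists (lattice d). f -` {a} \<inter> space M \<in> sets M)" for f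
    using cnt by (simp add: measurable_count_space_eq_countable)
  show ?case
    unfolding eq
  proof (intro conjI ballI)
    show "hist S (Suc n) \<in> space M \<rightarrow> lists (lattice d)"
      using measurable_space[OF Suc] measurable_space[OF S_measurable] by auto
    fix h assume "h \<in> lists (lattice d)"
    show "hist S (Suc n) -` {h} \<inter> space M \<in> sets M"
    proof (cases h)
      case (Cons y t)
      have "hist S (Suc n) -` {h} \<inter> space M
          = (S (Suc n) -` {y} \<inter> space M) \<inter> (hist S n -` {t} \<inter> space M)"
        by (auto simp: Cons)
      also have "\<dots> \<in> sets M"
        using \<open>h \<in> _\<close> measurable_sets[OF Suc, of "{t}"] measurable_sets[OF S_measurable, of "{y}" "Suc n"]
        by (auto simp: Cons)
      finally show ?thesis .
    next
      case Nil
      have "hist S (Suc n) -` {[]} = {}"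
        by auto
      then show ?thesis
        by (simp add: Nil del: hist.simps)
    qed
  qed
qed

lemma hist_event [measurable]: "{\<omega> \<in> space M. P (hist S n \<omega>)} \<in> sets M"
  using measurable_sets[OF hist_measurable, of "{h \<in> lists (lattice d). P h}" n]
    measurable_space[OF hist_measurable, of _ n]
  by (auto simp: vimage_def Int_def conj_commute cong: conj_cong)

text \<open>Conditional expectations given \<open>past\<close> may be integrated over these
  events.\<close>

lemma hist_past: "{\<omega> \<in> space M. hist S n \<omega> = h} \<in> sets (past M d S n)"
proof -
  have gen: "{S j -` A \<inter> space M | j A. j \<le> n \<and> A \<subseteq> lattice d} \<subseteq> Pow (space M)"
    by auto
  have "{\<omega> \<in> space M. hist S m \<omega> = h} \<in> sets (past M d S n)" if "m \<le> n" for m h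
    using that
  proof (induction m arbitrary: h)
    case 0
    \<comment> \<open>The generators of \<open>past\<close> use subsets of the lattice only, hence
      the intersection with \<open>lattice d\<close>.\<close>
    have *: "S 0 -` ({hd h} \<inter> lattice d) \<inter> space M \<in> sets (past M d S n)"
      unfolding past_def sets_measure_of[OF gen] by (intro sigma_sets.Basic) blast
    have "{\<omega> \<in> space M. hist S 0 \<omega> = h} =
        (if length h = 1 then S 0 -` ({hd h} \<inter> lattice d) \<inter> space M else {})"
      using measurable_space[OF S_measurable] by (cases h) (auto simp: length_Suc_conv)
    then show ?case
      using * by (simp split: if_splits)
  next
    case (Suc m)
    show ?case
    proof (cases h)
      case (Cons y t)
      have *: "S (Suc m) -` ({y} \<inter> lattice d) \<inter> space M \<in> sets (past M d S n)"
        unfolding past_def sets_measure_of[OF gen] using Suc.prems by (intro sigma_sets.Basic) blast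
      have "{\<omega> \<in> space M. hist S (Suc m) \<omega> = h} =
          (S (Suc m) -` ({y} \<inter> lattice d) \<inter> space M) \<inter> {\<omega> \<in> space M. hist S m \<omega> = t}"
        using measurable_space[OF S_measurable] by (auto simp: Cons)
      then show ?thesis
        using * Suc by auto
    qed auto
  qed
  then show ?thesis
    by simp
qed

lemma step_event_sets: "step_event M S n i s \<in> sets M"
proof -
  have "step_event M S n i s =
      {\<omega> \<in> space M. (\<lambda>k. hd (hist S (Suc n) \<omega>) k - hd (tl (hist S (Suc n) \<omega>)) k) = (\<lambda>k. s * basis_vec i k)}"
    by (auto simp: step_event_def)
  also have "\<dots> \<in> sets M"
    by (rule hist_event[of "\<lambda>h. (\<lambda>k. hd h k - hd (tl h) k) = (\<lambda>k. s * basis_vec i k)"])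
  finally show ?thesis .
qed

lemma AE_step_prob:
  assumes "i \<in> dirs h" "s \<in> {1, - 1}"
  shows "AE \<omega> in M. hist S n \<omega> = h \<longrightarrow>
    real_cond_exp M (past M d S n) (indicator (step_event M S n i s)) \<omega> = 1 / (2 * card (dirs h))"
proof (cases "fresh h")
  case True
  then have "AE \<omega> in M. (\<forall>j<n. S n \<omega> \<noteq> S j \<omega>) \<longrightarrow>
      real_cond_exp M (past M d S n) (indicator (step_event M S n i s)) \<omega> = 1 / (2 * real d1)"
    using assms by (intro fresh_step) (auto simp: dirs_def)
  then show ?thesis
    by eventually_elim (use True in \<open>auto simp: card_dirs fresh_hist\<close>)
next
  case False
  then have "AE \<omega> in M. (\<exists>j<n. S n \<omega> = S j \<omega>) \<longrightarrow>
      real_cond_exp M (past M d S n) (indicator (step_event M S n i s)) \<omega> = 1 / (2 * real d2)"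
    using assms by (intro revisit_step) (auto simp: dirs_def)
  then show ?thesis
    by eventually_elim (use False in \<open>auto simp: card_dirs fresh_hist\<close>)
qed

text \<open>On the event that the history is \<open>h\<close> the conditional step probability is
  almost surely constant, and this event belongs to \<open>past\<close>. Integrating the conditional
  expectation over it gives the product.\<close>

lemma prob_hist_step:
  assumes "i \<in> dirs h" "s \<in> {1, - 1}"
  shows "prob {\<omega> \<in> space M. hist S (Suc n) \<omega> = move (hd h) i s # h}
       = prob {\<omega> \<in> space M. hist S n \<omega> = h} / (2 * card (dirs h))"
proof -
  let ?F = "past M d S n" and ?A = "{\<omega> \<in> space M. hist S n \<omega> = h}" and ?B = "step_event M S n i s"
  interpret sigma_finite_subalgebra M ?F
    by (rule finite_measure_subalgebra_is_sigma_finite) (unfold_locales, rule subalgebra_past)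
  have A: "?A \<in> sets M" and B: "?B \<in> sets M"
    by (rule hist_event, rule step_event_sets)
  have "{\<omega> \<in> space M. hist S (Suc n) \<omega> = move (hd h) i s # h} = ?A \<inter> ?B"
    by (auto simp: step_event_def move_def fun_eq_iff algebra_simps)
  then have "prob {\<omega> \<in> space M. hist S (Suc n) \<omega> = move (hd h) i s # h} = prob (?A \<inter> ?B)"
    by simp
  also have "\<dots> = (\<integral>\<omega>. indicator (?A \<inter> ?B) \<omega> \<partial>M)"
    using A B by simp
  also have "\<dots> = (\<integral>\<omega>\<in>?A. indicator ?B \<omega> \<partial>M)"
    by (simp add: set_lebesgue_integral_def indicator_inter_arith)
  also have "\<dots> = (\<integral>\<omega>\<in>?A. real_cond_exp M ?F (indicator ?B) \<omega> \<partial>M)"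
    using B by (intro real_cond_exp_intA hist_past integrable_real_indicator) (auto simp: emeasure_eq_measure)
  also have "\<dots> = (\<integral>\<omega>\<in>?A. 1 / (2 * card (dirs h)) \<partial>M)"
    using A AE_step_prob[OF assms, of n] unfolding set_lebesgue_integral_def
    by (intro integral_cong_AE) (auto simp: indicator_def)
  also have "\<dots> = prob ?A / (2 * card (dirs h))"
    using A by (simp add: set_lebesgue_integral_def)
  finally show ?thesis .
qed

text \<open>Induction on time along the unique predecessor of a history. An inequality suffices,
  since comparing total masses turns it into an equality in \<open>prob_hist\<close>.\<close>

lemma pmf_walk_le_prob: "h \<in> set_pmf (walk n) \<Longrightarrow> pmf (walk n) h \<le> prob {\<omega> \<in> space M. hist S n \<omega> = h}"
proof (induction n arbitrary: h)
  case 0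
  have "prob {\<omega> \<in> space M. S 0 \<omega> = (\<lambda>_. 0)} = 1"
    using S_0 hist_event[of "\<lambda>h. hd h = (\<lambda>_. 0)" 0] by (subst prob_Collect_eq_1) auto
  then show ?case
    using 0 by simp
next
  case (Suc n)
  then obtain h' i s where h': "h' \<in> set_pmf (walk n)" "i \<in> dirs h'" "s \<in> {1, - 1}"
    and h: "h = move (hd h') i s # h'"
    by (meson walk_SucE)
  \<comment> \<open>The tail of \<open>h\<close> determines the predecessor \<open>h'\<close>, and
    because \<open>s\<close> is not 0 the move determines \<open>i\<close> and
    \<open>s\<close>.\<close>
  have "pmf (map_pmf (\<lambda>(i, s). move (hd h'') i s # h'') (pmf_of_set (dirs h'' \<times> {1, - 1}))) h
      = (if h'' = h' then 1 / (2 * card (dirs h')) else 0)" for h''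
  proof -
    have "(\<lambda>(i, s). move (hd h'') i s # h'') -` {h} \<inter> (dirs h'' \<times> {1, - 1}) =
        (if h'' = h' then {(i, s)} else {})"
      using h' by (auto simp: h move_eq_iff)
    then show ?thesis
      by (simp add: pmf_map measure_pmf_of_set Int_commute card_cartesian_product)
  qed
  then have "pmf (walk (Suc n)) h = expect n (\<lambda>h''. if h'' = h' then 1 / (2 * card (dirs h')) else 0)"
    by (simp add: pmf_bind)
  also have "\<dots> = expect n (\<lambda>h''. 1 / (2 * card (dirs h')) * indicator {h'} h'')"
    by (intro Bochner_Integration.integral_cong) (auto simp: indicator_def)
  also have "\<dots> = pmf (walk n) h' / (2 * card (dirs h'))"
    by (simp add: pmf.rep_eq)
  also have "\<dots> \<le> prob {\<omega> \<in> space M. hist S n \<omega> = h'} / (2 * card (dirs h'))"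
    by (intro divide_right_mono Suc.IH h') auto
  also have "\<dots> = prob {\<omega> \<in> space M. hist S (Suc n) \<omega> = h}"
    unfolding h by (rule prob_hist_step[symmetric]) (use h' in auto)
  finally show ?case .
qed

text \<open>The pointwise inequality is summed both over \<open>P\<close> and over its negation. In
  each measure the two probabilities add up to 1, so neither inequality can be strict.\<close>

lemma prob_hist: "prob {\<omega> \<in> space M. P (hist S n \<omega>)} = measure (walk n) {h. P h}"
proof -
  have le: "measure (walk n) {h. Q h} \<le> prob {\<omega> \<in> space M. Q (hist S n \<omega>)}" for Q
  proof -
    let ?A = "{h. Q h} \<inter> set_pmf (walk n)"
    have fin: "finite ?A"
      by simp
    have "measure (walk n) {h. Q h} = measure (walk n) ?A"
      by (simp add: measure_Int_set_pmf)
    also have "\<dots> = (\<Sum>h\<in>?A. pmf (walk n) h)"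
      by (rule measure_measure_pmf_finite) simp
    also have "\<dots> \<le> (\<Sum>h\<in>?A. prob {\<omega> \<in> space M. hist S n \<omega> = h})"
      by (intro sum_mono pmf_walk_le_prob) auto
    also have "\<dots> = prob (\<Union>h\<in>?A. {\<omega> \<in> space M. hist S n \<omega> = h})"
      using fin by (intro finite_measure_finite_Union[symmetric]) (auto simp: disjoint_family_on_def)
    also have "\<dots> \<le> prob {\<omega> \<in> space M. Q (hist S n \<omega>)}"
      by (intro finite_measure_mono) auto
    finally show ?thesis .
  qed
  have "prob {\<omega> \<in> space M. \<not> P (hist S n \<omega>)} = 1 - prob {\<omega> \<in> space M. P (hist S n \<omega>)}"
    by (rule prob_neg) simp
  moreover have "measure (walk n) {h. \<not> P h} = 1 - measure (walk n) {h. P h}"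
    using measure_pmf.prob_compl[of "{h. P h}" "walk n"] by (simp add: Compl_eq_Diff_UNIV[symmetric] Collect_neg_eq)
  ultimately show ?thesis
    using le[of P] le[of "\<lambda>h. \<not> P h"] by simp
qed

lemma AE_hist_walk: "AE \<omega> in M. \<forall>n. hist S n \<omega> \<in> set_pmf (walk n)"
  unfolding AE_all_countable
proof
  fix n
  have "prob {\<omega> \<in> space M. hist S n \<omega> \<in> set_pmf (walk n)} = 1"
    unfolding prob_hist[of "\<lambda>h. h \<in> set_pmf (walk n)"]
    by (simp add: measure_pmf.prob_eq_1 AE_measure_pmf)
  then show "AE \<omega> in M. hist S n \<omega> \<in> set_pmf (walk n)"
    by (subst (asm) prob_Collect_eq_1) simp_all
qed

text \<open>The first Borel-Cantelli lemma. The times \<open>t k\<close> are free so that it also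
  applies along powers of two.\<close>

lemma AE_eventually_not:
  assumes "summable (\<lambda>k. measure (walk (t k)) {h. P k h})"
  shows "AE \<omega> in M. eventually (\<lambda>k. \<not> P k (hist S (t k) \<omega>)) sequentially"
proof -
  have "AE \<omega> in M. eventually (\<lambda>k. \<omega> \<in> space M - {\<omega> \<in> space M. P k (hist S (t k) \<omega>)}) sequentially"
    using assms by (intro borel_cantelli_AE1) (simp_all add: prob_hist emeasure_eq_measure)
  then show ?thesis
    by eventually_elim (auto elim: eventually_mono)
qed

end

section \<open>Negative powers of a quadratic form\<close>

text \<open>Taylor expansion at 1 with Lagrange remainder: between 1/2 and 3/2 the third derivative
  is at most \<open>6 * 16 * b\<close> in absolute value, and division by 3! leaves
  \<open>16 * b\<close>.\<close>

lemma powr_minus_upper: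
  fixes b u :: real
  assumes b: "0 < b" "b \<le> 1" and u: "\<bar>u\<bar> \<le> 1 / 2"
  shows "(1 + u) powr (- b) \<le> 1 - b * u + b * (b + 1) / 2 * u\<^sup>2 + 16 * b * \<bar>u\<bar> ^ 3"
proof (cases "u = 0")
  case False
  \<comment> \<open>The derivatives of \<open>t powr (- b)\<close> up to the third; for larger
    \<open>m\<close> the formula has no meaning as a derivative.\<close>
  define diff :: "nat \<Rightarrow> real \<Rightarrow> real" where "diff m t =
    (if m = 0 then 1 else if m = 1 then - b else if m = 2 then b * (b + 1)
      else - b * (b + 1) * (b + 2)) * t powr (- b - m)" for m t
  have der: "(diff m has_real_derivative diff (Suc m) t) (at t)" if "m < 3" "1 / 2 \<le> t" for m t
  proof -
    have "m = 0 \<or> m = 1 \<or> m = 2"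
      using that by auto
    then show ?thesis
      unfolding diff_def using that
      by (elim disjE) (auto intro!: derivative_eq_intros simp: algebra_simps)
  qed
  have "\<exists>t. (if 1 + u < 1 then 1 + u < t \<and> t < 1 else 1 < t \<and> t < 1 + u) \<and>
      diff 0 (1 + u) = (\<Sum>m<3. (diff m 1 / fact m) * (1 + u - 1) ^ m)
        + (diff 3 t / fact 3) * (1 + u - 1) ^ 3"
    by (rule Taylor[where a = "1 / 2" and b = "3 / 2"]) (use der u False in \<open>auto simp: abs_le_iff\<close>)
  then obtain t where t: "if 1 + u < 1 then 1 + u < t \<and> t < 1 else 1 < t \<and> t < 1 + u"
    and eq: "diff 0 (1 + u) = (\<Sum>m<3. (diff m 1 / fact m) * (1 + u - 1) ^ m)
        + (diff 3 t / fact 3) * (1 + u - 1) ^ 3"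
    by blast
  have t12: "1 / 2 \<le> t"
    using t u by (auto split: if_splits simp: abs_le_iff)
  have "t powr (- b - 3) \<le> (1 / 2) powr (- b - 3)"
    using t12 b by (intro powr_mono2') auto
  also have "\<dots> \<le> (1 / 2) powr (- 4)"
    using b by (intro powr_mono') auto
  also have "\<dots> = 16"
    by (simp add: powr_minus powr_numeral field_simps)
  finally have t16: "t powr (- b - 3) \<le> 16" .
  have "(b + 1) * (b + 2) \<le> 2 * 3"
    using b by (intro mult_mono) auto
  then have "b * ((b + 1) * (b + 2) * t powr (- b - 3)) \<le> b * (6 * 16)"
    using t16 b by (intro mult_left_mono mult_mono) auto
  then have "\<bar>diff 3 t\<bar> \<le> 96 * b"
    using b by (simp add: diff_def abs_mult mult_ac)
  then have "\<bar>diff 3 t\<bar> * \<bar>u\<bar> ^ 3 \<le> 96 * b * \<bar>u\<bar> ^ 3"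
    by (intro mult_right_mono) auto
  then have "diff 3 t * u ^ 3 \<le> 96 * b * \<bar>u\<bar> ^ 3"
    by (metis abs_ge_self abs_mult order_trans power_abs)
  moreover have "diff 0 (1 + u) = 1 - b * u + b * (b + 1) / 2 * u\<^sup>2 + diff 3 t * u ^ 3 / 6"
    unfolding eq by (simp add: diff_def numeral_3_eq_3 fact_numeral power2_eq_square)
  ultimately show ?thesis
    by (simp add: diff_def)
qed auto

text \<open>The exact second difference of \<open>B powr (- b)\<close> along one coordinate would have no
  \<open>1 / 1000\<close>; this term absorbs the discretisation error, which is small because \<open>B\<close> is
  bounded below by a huge constant.\<close>

lemma coordinate_drift:
  fixes b B w x :: real
  assumes b: "0 < b" "b \<le> 1" and B: "10 ^ 12 \<le> B" and w: "0 \<le> w" "w \<le> 1" and x: "w * x\<^sup>2 \<le> B"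
  shows "((B + w * (2 * x + 1)) powr (- b) + (B + w * (- 2 * x + 1)) powr (- b)) / 2
    \<le> B powr (- b) + b * B powr (- b - 1) * (w * (- 1 + 2 * (b + 1) * (w * x\<^sup>2 / B) + 1 / 1000))"
proof -
  have B0: "B > 0"
    using B by auto
  \<comment> \<open>A common small scale: both \<open>w * \<bar>x\<bar> / B\<close> and
    \<open>w / B\<close> are at most \<open>r\<close>, so the relative increment \<open>u\<close>
    below is at most \<open>3 * r\<close>. Its cube is then at most \<open>27 * r\<close> times
    \<open>w / B\<close>, and 432 is 16 times 27.\<close>
  define r where "r = sqrt (w / B)"
  have r2: "r\<^sup>2 = w / B" and r0: "0 \<le> r"
    using w B0 by (simp_all add: r_def)
  have "w / B \<le> 1 / 10 ^ 12"
    using w B B0 by (intro frac_le) auto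
  then have "r\<^sup>2 \<le> (1 / 10 ^ 6)\<^sup>2"
    unfolding r2 by (simp add: power2_eq_square)
  then have r6: "r \<le> 1 / 10 ^ 6"
    by (rule power2_le_imp_le) simp
  have "(w * \<bar>x\<bar> / B)\<^sup>2 = (w / B) * (w * x\<^sup>2 / B)"
    by (simp add: power2_eq_square)
  also have "\<dots> \<le> (w / B) * 1"
    using w x B0 by (intro mult_left_mono) (auto simp: divide_le_eq)
  finally have "(w * \<bar>x\<bar> / B)\<^sup>2 \<le> r\<^sup>2"
    by (simp add: r2)
  then have wx: "w * \<bar>x\<bar> / B \<le> r"
    using r0 by (rule power2_le_imp_le)
  have wB: "w / B \<le> r"
    using r2 r0 r6 mult_left_mono[of r 1 r] by (simp add: power2_eq_square)
  have step: "(B + w * (2 * y + 1)) powr (- b) \<le> B powr (- b) *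
      (1 - b * (w * (2 * y + 1) / B) + b * (b + 1) / 2 * (w * (2 * y + 1) / B)\<^sup>2
        + b * (w / B) * (432 / 10 ^ 6))"
    if y: "\<bar>y\<bar> = \<bar>x\<bar>" for y
  proof -
    define u where "u = w * (2 * y + 1) / B"
    have "\<bar>u\<bar> = w / B * \<bar>2 * y + 1\<bar>"
      using w B0 by (simp add: u_def abs_mult)
    also have "\<dots> \<le> w / B * (2 * \<bar>y\<bar> + 1)"
      using w B0 by (intro mult_left_mono) auto
    also have "\<dots> = 2 * (w * \<bar>x\<bar> / B) + w / B"
      by (simp add: y algebra_simps)
    finally have u3: "\<bar>u\<bar> \<le> 3 * r"
      using wx wB by linarith
    then have "\<bar>u\<bar> ^ 3 \<le> (3 * r) ^ 3"
      by (intro power_mono) auto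
    also have "\<dots> = 27 * r * r\<^sup>2"
      by (simp add: power3_eq_cube power2_eq_square)
    also have "\<dots> \<le> 27 * (1 / 10 ^ 6) * r\<^sup>2"
      using r6 by (intro mult_right_mono mult_left_mono) auto
    finally have "\<bar>u\<bar> ^ 3 \<le> 27 / 10 ^ 6 * (w / B)"
      by (simp add: r2)
    then have "16 * b * \<bar>u\<bar> ^ 3 \<le> 16 * b * (27 / 10 ^ 6 * (w / B))"
      using b by (intro mult_left_mono) auto
    also have "\<dots> = b * (w / B) * (432 / 10 ^ 6)"
      by simp
    finally have cub: "16 * b * \<bar>u\<bar> ^ 3 \<le> b * (w / B) * (432 / 10 ^ 6)" .
    have u12: "\<bar>u\<bar> \<le> 1 / 2"
      using u3 r6 by simp
    have "B + w * (2 * y + 1) = B * (1 + u)"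
      using B0 by (simp add: u_def field_simps)
    then have "(B + w * (2 * y + 1)) powr (- b) = B powr (- b) * (1 + u) powr (- b)"
      using B0 u12 by (simp add: powr_mult abs_le_iff)
    also have "\<dots> \<le> B powr (- b) *
        (1 - b * u + b * (b + 1) / 2 * u\<^sup>2 + b * (w / B) * (432 / 10 ^ 6))"
      using powr_minus_upper[OF b u12] cub by (intro mult_left_mono) auto
    finally show ?thesis
      by (simp add: u_def)
  qed
  have "w * w \<le> 1 * w"
    using w by (intro mult_right_mono) auto
  then have "w * w / (B * B) \<le> w / (B * 10 ^ 12)"
    using B B0 w by (intro frac_le mult_left_mono) auto
  then have "b * (b + 1) / 2 * (w\<^sup>2 / B\<^sup>2) \<le> b * (1 + 1) / 2 * (w / (B * 10 ^ 12))"
    using b w B0 by (intro mult_mono divide_right_mono mult_left_mono) (auto simp: power2_eq_square)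
  then have small: "b * (b + 1) / 2 * (w\<^sup>2 / B\<^sup>2) \<le> b * (w / B) * (1 / 10 ^ 12)"
    by simp
  have nn: "0 \<le> b * (w / B)"
    using b w B0 by simp
  let ?P = "\<lambda>y. 1 - b * (w * (2 * y + 1) / B) + b * (b + 1) / 2 * (w * (2 * y + 1) / B)\<^sup>2
        + b * (w / B) * (432 / 10 ^ 6)"
  \<comment> \<open>Averaging over the two signs cancels the terms that are odd in
    \<open>x\<close>.\<close>
  have "(?P x + ?P (- x)) / 2 = 1 - b * (w / B) + b * (b + 1) / 2 * (4 * (w / B) * (w * x\<^sup>2 / B) + w\<^sup>2 / B\<^sup>2)
      + b * (w / B) * (432 / 10 ^ 6)"
    using B0 by (simp add: field_simps power2_eq_square)
  also have "\<dots> \<le> 1 - b * (w / B) + b * (b + 1) / 2 * (4 * (w / B) * (w * x\<^sup>2 / B))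
      + b * (w / B) * (1 / 1000)"
    using small nn by (simp add: ring_distribs)
  also have "\<dots> = 1 + b * (w / B) * (- 1 + 2 * (b + 1) * (w * x\<^sup>2 / B) + 1 / 1000)"
  proof -
    have "1 - b * v + b * (b + 1) / 2 * (4 * v * k) + b * v * (1 / 1000)
        = 1 + b * v * (- 1 + 2 * (b + 1) * k + 1 / 1000)" for v k
      by (simp add: field_simps)
    then show ?thesis .
  qed
  finally have P: "(?P x + ?P (- x)) / 2 \<le> 1 + b * (w / B) * (- 1 + 2 * (b + 1) * (w * x\<^sup>2 / B) + 1 / 1000)" .
  have "((B + w * (2 * x + 1)) powr (- b) + (B + w * (- 2 * x + 1)) powr (- b)) / 2
      \<le> (B powr (- b) * ?P x + B powr (- b) * ?P (- x)) / 2"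
    using step[of x] step[of "- x"] by (intro divide_right_mono add_mono) auto
  also have "\<dots> = B powr (- b) * ((?P x + ?P (- x)) / 2)"
    by (simp add: algebra_simps)
  also have "\<dots> \<le> B powr (- b) * (1 + b * (w / B) * (- 1 + 2 * (b + 1) * (w * x\<^sup>2 / B) + 1 / 1000))"
    by (intro mult_left_mono P) auto
  also have "\<dots> = B powr (- b) + b * (B powr (- b) / B) * (w * (- 1 + 2 * (b + 1) * (w * x\<^sup>2 / B) + 1 / 1000))"
    by (simp add: algebra_simps)
  also have "B powr (- b) / B = B powr (- b - 1)"
    using B0 by (simp add: powr_diff)
  finally show ?thesis .
qed

context excited_params
begin

text \<open>The weights select or discount coordinates. The shift \<open>10 ^ 12\<close> makes one
  step a tiny relative change everywhere, including near the origin.\<close>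

definition pot :: "(nat \<Rightarrow> real) \<Rightarrow> (nat \<Rightarrow> int) \<Rightarrow> real" where
  "pot w x = 10 ^ 12 + (\<Sum>i\<in>{1..d}. w i * (real_of_int (x i))\<^sup>2)"

abbreviation lyap :: "(nat \<Rightarrow> real) \<Rightarrow> (nat \<Rightarrow> int) \<Rightarrow> real" where
  "lyap w x \<equiv> pot w x powr (- (1 / 1000))"

abbreviation rate :: "(nat \<Rightarrow> real) \<Rightarrow> (nat \<Rightarrow> int) \<Rightarrow> real" where
  "rate w x \<equiv> pot w x powr (- (1 / 1000) - 1)"

lemma pot_ge: "(\<And>i. 0 \<le> w i) \<Longrightarrow> 10 ^ 12 \<le> pot w x"
  by (simp add: pot_def sum_nonneg)

lemma pot_move:
  assumes "i \<in> {1..d}" "s \<in> {1, - 1}"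
  shows "pot w (move x i s) = pot w x + w i * (2 * of_int s * real_of_int (x i) + 1)"
proof -
  have eq: "(\<Sum>j\<in>{1..d} - {i}. w j * (real_of_int (move x i s j))\<^sup>2)
      = (\<Sum>j\<in>{1..d} - {i}. w j * (real_of_int (x j))\<^sup>2)"
    by (intro sum.cong) auto
  have "w i * (real_of_int (move x i s i))\<^sup>2
      = w i * (real_of_int (x i))\<^sup>2 + w i * (2 * of_int s * real_of_int (x i) + 1)"
    using assms(2) by (auto simp: power2_eq_square algebra_simps)
  then show ?thesis
    unfolding pot_def using assms(1) by (simp add: sum.remove[of _ i] eq)
qed

lemma coordinate_le_pot:
  assumes "\<And>i. 0 \<le> w i" "i \<in> {1..d}"
  shows "w i * (real_of_int (x i))\<^sup>2 \<le> pot w x"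
proof -
  have "w i * (real_of_int (x i))\<^sup>2 \<le> (\<Sum>i\<in>{1..d}. w i * (real_of_int (x i))\<^sup>2)"
    using assms by (intro member_le_sum) auto
  then show ?thesis
    by (simp add: pot_def)
qed

text \<open>The coordinate estimates are summed; the quadratic terms together cost at most about
  \<open>2 * W\<close>, because the weighted squares add up to at most \<open>pot\<close>. The drift
  is therefore negative once the weights of the available directions sum to clearly more than
  \<open>2 * W\<close>, as for three directions of equal weight.\<close>

lemma avg_lyap:
  assumes w: "\<And>i. 0 \<le> w i" "\<And>i. w i \<le> 1" and W: "0 \<le> W" "\<And>i. i \<in> dirs h \<Longrightarrow> w i \<le> W"
  shows "avg (\<lambda>h. lyap w (hd h)) h \<le> lyap w (hd h) + 1 / 1000 * rate w (hd h) *
    ((2002 / 1000 * W - 999 / 1000 * (\<Sum>i\<in>dirs h. w i)) / card (dirs h))"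
proof -
  let ?B = "pot w (hd h)" and ?c = "card (dirs h)"
  let ?x = "\<lambda>i. real_of_int (hd h i)"
  have B0: "0 < ?B"
    using pot_ge[of w "hd h"] w by simp
  have "(\<Sum>i\<in>dirs h. w i * (w i * (?x i)\<^sup>2 / ?B)) \<le> (\<Sum>i\<in>dirs h. W * (w i * (?x i)\<^sup>2 / ?B))"
    using w W B0 by (intro sum_mono mult_right_mono) auto
  also have "\<dots> = W * ((\<Sum>i\<in>dirs h. w i * (?x i)\<^sup>2) / ?B)"
    by (simp add: sum_distrib_left sum_divide_distrib)
  also have "\<dots> \<le> W * 1"
  proof (intro mult_left_mono W)
    have "(\<Sum>i\<in>dirs h. w i * (?x i)\<^sup>2) \<le> (\<Sum>i\<in>{1..d}. w i * (?x i)\<^sup>2)"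
      using dirs_subset w by (intro sum_mono2) auto
    also have "\<dots> \<le> ?B"
      by (simp add: pot_def)
    finally show "(\<Sum>i\<in>dirs h. w i * (?x i)\<^sup>2) / ?B \<le> 1"
      using B0 by simp
  qed
  finally have quad: "(\<Sum>i\<in>dirs h. w i * (w i * (?x i)\<^sup>2 / ?B)) \<le> W"
    by simp
  have "(lyap w (move (hd h) i 1) + lyap w (move (hd h) i (- 1))) / 2 \<le> lyap w (hd h) + 1 / 1000 *
      rate w (hd h) * (w i * (- 1 + 2 * (1 / 1000 + 1) * (w i * (?x i)\<^sup>2 / ?B) + 1 / 1000))"
    if "i \<in> dirs h" for i
    using coordinate_drift[of "1 / 1000" ?B "w i" "?x i"] that dirs_subset[of h] w
      pot_ge[of w "hd h"] coordinate_le_pot[of w i "hd h"]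
    by (auto simp: pot_move subset_iff)
  then have "(\<Sum>i\<in>dirs h. (lyap w (move (hd h) i 1) + lyap w (move (hd h) i (- 1))) / 2)
      \<le> (\<Sum>i\<in>dirs h. lyap w (hd h) + 1 / 1000 *
      rate w (hd h) * (w i * (- 1 + 2 * (1 / 1000 + 1) * (w i * (?x i)\<^sup>2 / ?B) + 1 / 1000)))"
    by (rule sum_mono)
  also have "\<dots> = ?c * lyap w (hd h) + 1 / 1000 * rate w (hd h) *
      (2002 / 1000 * (\<Sum>i\<in>dirs h. w i * (w i * (?x i)\<^sup>2 / ?B)) - 999 / 1000 * (\<Sum>i\<in>dirs h. w i))"
    by (simp add: sum.distrib sum_distrib_left sum_distrib_right sum_subtractf algebra_simps)
  also have "\<dots> \<le> ?c * lyap w (hd h) + 1 / 1000 * rate w (hd h) *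
      (2002 / 1000 * W - 999 / 1000 * (\<Sum>i\<in>dirs h. w i))"
    using quad by (intro add_left_mono mult_left_mono diff_right_mono) auto
  finally have "(\<Sum>i\<in>dirs h. lyap w (move (hd h) i 1) + lyap w (move (hd h) i (- 1))) / 2 / ?c
      \<le> (?c * lyap w (hd h) + 1 / 1000 * rate w (hd h) *
        (2002 / 1000 * W - 999 / 1000 * (\<Sum>i\<in>dirs h. w i))) / ?c"
    by (intro divide_right_mono) (simp_all add: sum_divide_distrib)
  then show ?thesis
    using card_dirs_pos[of h] by (simp add: avg_def add_divide_distrib)
qed

text \<open>A step lowers \<open>pot\<close> by at most a thousandth of its value. This allows
  factors that change with the history, such as \<open>bonus\<close>, to be multiplied by
  \<open>rate\<close>.\<close>

lemma rate_move_le: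
  assumes w: "\<And>i. 0 \<le> w i" "\<And>i. w i \<le> 1" and "i \<in> {1..d}" "s \<in> {1, - 1}"
  shows "rate w (move x i s) \<le> 101 / 100 * rate w x"
proof -
  let ?B = "pot w x" and ?x = "real_of_int (x i)"
  have B: "10 ^ 12 \<le> ?B"
    using w by (intro pot_ge)
  have "(w i * \<bar>?x\<bar>)\<^sup>2 = w i * (w i * ?x\<^sup>2)"
    by (simp add: power2_eq_square)
  also have "\<dots> \<le> 1 * ?B"
    using w assms(3) B by (intro mult_mono coordinate_le_pot) auto
  finally have "(w i * \<bar>?x\<bar>)\<^sup>2 * 10 ^ 12 \<le> ?B * 10 ^ 12"
    by simp
  also have "\<dots> \<le> ?B * ?B"
    using B by (intro mult_left_mono) auto
  finally have "(w i * \<bar>?x\<bar> * 10 ^ 6)\<^sup>2 \<le> ?B\<^sup>2"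
    by (simp add: power_mult_distrib) (simp add: power2_eq_square)
  then have "w i * \<bar>?x\<bar> * 10 ^ 6 \<le> ?B"
    by (rule power2_le_imp_le) (use B in auto)
  moreover have "- \<bar>?x\<bar> \<le> of_int s * ?x"
    using assms(4) by auto
  from mult_left_mono[OF this w(1)[of i]]
  have "- (w i * \<bar>?x\<bar>) \<le> w i * (of_int s * ?x)"
    by simp
  ultimately have "?B - ?B / 1000 \<le> pot w (move x i s)"
    using w(1)[of i] B unfolding pot_move[OF assms(3,4)] by (simp add: distrib_left)
  then have "rate w (move x i s) \<le> (999 / 1000 * ?B) powr (- (1 / 1000) - 1)"
    using B by (intro powr_mono2') auto
  also have "\<dots> = (999 / 1000) powr (- (1 / 1000) - 1) * rate w x"
    using B powr_mult[of "999 / 1000" ?B "- (1 / 1000) - 1"] by simp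
  also have "\<dots> \<le> 101 / 100 * rate w x"
  proof (intro mult_right_mono)
    have "(999 / 1000 :: real) powr (- (1 / 1000) - 1) \<le> (999 / 1000) powr (- 2)"
      by (intro powr_mono') auto
    also have "\<dots> \<le> 101 / 100"
      by (simp add: powr_minus powr_numeral power2_eq_square field_simps)
    finally show "(999 / 1000 :: real) powr (- (1 / 1000) - 1) \<le> 101 / 100" .
  qed auto
  finally show ?thesis .
qed

end

section \<open>Summable visit probabilities from drift\<close>

lemma summable_of_bounded_sums:
  fixes a :: "nat \<Rightarrow> real"
  assumes "\<And>n. 0 \<le> a n" "0 < c" "\<And>n. (\<Sum>j<n. c * a j) \<le> C"
  shows "summable a"
proof (rule bounded_imp_summable)
  show "0 \<le> a n" for n
    by (rule assms)
  show "(\<Sum>k\<le>n. a k) \<le> C / c" for n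
    using assms(3)[of "Suc n"] assms(2)
    by (simp add: lessThan_Suc_atMost sum_distrib_left[symmetric] field_simps)
qed

context excited_params
begin

lemma pot_pos: "(\<And>i. 0 \<le> w i) \<Longrightarrow> 0 < pot w x"
  using pot_ge[of w x] by simp

lemma summable_prob_of_drift:
  assumes drift: "\<And>n h. h \<in> set_pmf (walk n) \<Longrightarrow> avg \<Phi> h + g h \<le> \<Phi> h"
    and nonneg: "\<And>n h. h \<in> set_pmf (walk n) \<Longrightarrow> 0 \<le> \<Phi> h"
    and g: "\<And>n h. h \<in> set_pmf (walk n) \<Longrightarrow> 0 \<le> g h" "0 < c"
      "\<And>n h. h \<in> set_pmf (walk n) \<Longrightarrow> P h \<Longrightarrow> c \<le> g h"
  shows "summable (\<lambda>n. measure (walk n) {h. P h})"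
proof (rule summable_of_bounded_sums)
  fix n
  have "(\<Sum>j<n. c * measure (walk j) {h. P h}) \<le> (\<Sum>j<n. expect j g)"
    by (intro sum_mono prob_le_expect) (auto intro: g)
  also have "\<dots> \<le> \<Phi> [\<lambda>_. 0]"
    by (intro sum_expect_le drift nonneg)
  finally show "(\<Sum>j<n. c * measure (walk j) {h. P h}) \<le> \<Phi> [\<lambda>_. 0]" .
qed (auto intro: g)

text \<open>If \<open>d1 \<le> 2\<close>, the function \<open>lyap\<close> may increase slightly on average at a fresh site. But a
  fresh site reached from a fresh site is left backwards, towards a visited site, with
  probability at least \<open>1 / 4\<close>. The weight \<open>bonus\<close> turns this into a one-step drift.\<close>

definition bonus :: "(nat \<Rightarrow> int) list \<Rightarrow> real" where
  "bonus h = (if \<not> fresh h then 0 else if tl h \<noteq> [] \<and> fresh (tl h) then 1 / 40 else 1 / 20)"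

lemma bonus_bounds: "0 \<le> bonus h" "bonus h \<le> 1 / 20"
  by (simp_all add: bonus_def)

lemma avg_add: "avg (\<lambda>h. \<Phi> h + \<Psi> h) h = avg \<Phi> h + avg \<Psi> h"
  by (simp add: avg_def sum.distrib add_divide_distrib[symmetric] algebra_simps)

lemma avg_cmult: "avg (\<lambda>h. c * \<Phi> h) h = c * avg \<Phi> h"
  by (simp add: avg_def sum_distrib_left distrib_left)

lemma avg_mono:
  assumes "\<And>i s. i \<in> dirs h \<Longrightarrow> s \<in> {1, - 1} \<Longrightarrow> \<Phi> (move (hd h) i s # h) \<le> \<Psi> (move (hd h) i s # h)"
  shows "avg \<Phi> h \<le> avg \<Psi> h"
  unfolding avg_def using assms by (intro divide_right_mono sum_mono add_mono) auto

lemma avg_const: "avg (\<lambda>_. c) h = c"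
  using card_dirs_pos[of h] by (simp add: avg_def)

text \<open>After an isolated fresh site the bonus at most halves to 1/40. After two fresh sites in
  a row, one of the \<open>2 * d1\<close> moves leads back and earns 0 while the others earn at most
  1/40, a contraction by at most \<open>(2 * d1 - 1) / (2 * d1)\<close>, which is at most 3/4 for
  \<open>d1 \<le> 2\<close>.\<close>

lemma avg_bonus:
  assumes h: "h \<in> set_pmf (walk n)" and d1: "d1 \<le> 2"
  shows "avg bonus h \<le> (if \<not> fresh h then 1 / 20 else 3 / 4 * bonus h)"
proof -
  consider (old) "\<not> fresh h" | (isolated) "fresh h" "tl h = [] \<or> \<not> fresh (tl h)"
    | (double) "fresh h" "tl h \<noteq> []" "fresh (tl h)"
    by blast
  then show ?thesis
  proof cases
    case old
    have "avg bonus h \<le> avg (\<lambda>_. 1 / 20) h"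
      by (intro avg_mono bonus_bounds)
    then show ?thesis
      using old by (simp add: avg_const)
  next
    case isolated
    have "avg bonus h \<le> avg (\<lambda>_. 1 / 40) h"
      using isolated walk_nonempty[OF h] by (intro avg_mono) (auto simp: bonus_def)
    then show ?thesis
      using isolated by (auto simp: avg_const bonus_def)
  next
    case double
    then have "n \<noteq> 0"
      using length_walk[OF h] by (cases n) (auto simp: length_Suc_conv)
    then obtain m where "n = Suc m"
      by (cases n) auto
    with h obtain g i s where g: "g \<in> set_pmf (walk m)" "i \<in> dirs g" "s \<in> {1, - 1}" "h = move (hd g) i s # g"
      by (meson walk_SucE)
    have "fresh g"
      using double g by simp
    \<comment> \<open>The last step started at a fresh site too, so its direction is available again
      and can be reversed.\<close>
    then have i: "i \<in> dirs h"
      using g double by (simp add: dirs_def)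
    have le: "bonus (move (hd h) j t # h) \<le> 1 / 40" for j t
      using double by (simp add: bonus_def g(4))
    have "move (hd h) i (- s) = hd g"
      by (auto simp: move_apply g(4))
    then have "\<not> fresh (move (hd h) i (- s) # h)"
      using walk_nonempty[OF g(1)] by (simp add: fresh_def g(4))
    then have zero: "bonus (move (hd h) i (- s) # h) = 0"
      by (simp add: bonus_def)
    let ?b = "\<lambda>j. bonus (move (hd h) j 1 # h) + bonus (move (hd h) j (- 1) # h)"
    have "(\<Sum>j\<in>dirs h - {i}. ?b j) \<le> (\<Sum>j\<in>dirs h - {i}. 1 / 40 + 1 / 40)"
      by (intro sum_mono add_mono le)
    also have "\<dots> = (real d1 - 1) / 20"
      using i double d1_pos by (simp add: card_dirs of_nat_diff)
    finally have "(\<Sum>j\<in>dirs h - {i}. ?b j) \<le> (real d1 - 1) / 20" .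
    moreover have "?b i \<le> 1 / 40"
      using g(3) zero le[of i 1] le[of i "- 1"] by auto
    moreover have "(\<Sum>j\<in>dirs h. ?b j) = ?b i + (\<Sum>j\<in>dirs h - {i}. ?b j)"
      using i by (intro sum.remove) auto
    ultimately have "(\<Sum>j\<in>dirs h. ?b j) \<le> 1 / 40 + (real d1 - 1) / 20"
      by linarith
    also have "\<dots> \<le> 3 / 160 * (2 * d1)"
      using d1 by (simp add: field_simps)
    finally have "avg bonus h \<le> 3 / 160"
      using double d1_pos by (simp add: avg_def card_dirs divide_le_eq)
    then show ?thesis
      using double by (simp add: bonus_def)
  qed
qed

lemma avg_bonus_rate:
  assumes w: "\<And>i. 0 \<le> w i" "\<And>i. w i \<le> 1"
  shows "avg (\<lambda>h. bonus h * rate w (hd h)) h \<le> 101 / 100 * rate w (hd h) * avg bonus h"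
proof -
  have "avg (\<lambda>h. bonus h * rate w (hd h)) h \<le> avg (\<lambda>h'. 101 / 100 * rate w (hd h) * bonus h') h"
  proof (rule avg_mono)
    fix i s assume "i \<in> dirs h" "s \<in> {1, - 1 :: int}"
    then have "rate w (move (hd h) i s) \<le> 101 / 100 * rate w (hd h)"
      using dirs_subset[of h] w by (intro rate_move_le) auto
    then show "bonus (move (hd h) i s # h) * rate w (hd (move (hd h) i s # h))
        \<le> 101 / 100 * rate w (hd h) * bonus (move (hd h) i s # h)"
      using mult_left_mono[OF _ bonus_bounds(1), of "rate w (move (hd h) i s)"]
      by (simp only: list.sel mult.commute[of "101 / 100 * rate w (hd h)"])
  qed
  then show ?thesis
    by (simp only: avg_cmult)
qed

lemma rate_pos: "(\<And>i. 0 \<le> w i) \<Longrightarrow> 0 < rate w x"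
  using pot_pos[of w x] by simp

lemma summable_visits_of_drift_bounds:
  assumes w: "\<And>i. 0 \<le> w i" "\<And>i. w i \<le> 1"
    and revisit: "\<And>h. \<not> fresh h \<Longrightarrow> avg (\<lambda>h. lyap w (hd h)) h \<le> lyap w (hd h) - 1 / 1000 * rate w (hd h) / 5"
    and fresh: "\<And>h. fresh h \<Longrightarrow>
      avg (\<lambda>h. lyap w (hd h)) h \<le> lyap w (hd h) + 1 / 1000 * rate w (hd h) * (if d1 \<le> 2 then 1 / 400 else - 1 / 5)"
  shows "summable (\<lambda>n. measure (walk n) {h. hd h = x})"
proof (rule summable_prob_of_drift)
  \<comment> \<open>In units of \<open>rate / 1000\<close>: at a revisited site the bonus term gains
    at most 101/2000 against a loss of 1/5. At a fresh site it loses at least 97/400 of a bonus that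
    is at least 1/40, which exceeds the possible gain 1/400. If \<open>d1 \<ge> 3\<close>, the
    function \<open>lyap\<close> decreases by itself.\<close>
  define \<kappa> :: real where "\<kappa> = (if d1 \<le> 2 then 1 / 1000 else 0)"
  let ?\<Phi> = "\<lambda>h. lyap w (hd h) + \<kappa> * (bonus h * rate w (hd h))"
  let ?g = "\<lambda>h. 1 / 1000000 * rate w (hd h)"
  show "avg ?\<Phi> h + ?g h \<le> ?\<Phi> h" if h: "h \<in> set_pmf (walk n)" for n h
  proof -
    define \<rho> where "\<rho> = rate w (hd h)"
    define l where "l = lyap w (hd h)"
    have r: "0 < \<rho>"
      unfolding \<rho>_def using w by (intro rate_pos)
    have rev: "\<not> fresh h \<Longrightarrow> avg (\<lambda>h. lyap w (hd h)) h \<le> l - \<rho> / 5000"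
      using revisit[of h] by (simp add: l_def \<rho>_def)
    have fr: "fresh h \<Longrightarrow> avg (\<lambda>h. lyap w (hd h)) h \<le> l + 1 / 1000 * \<rho> * (if d1 \<le> 2 then 1 / 400 else - 1 / 5)"
      using fresh[of h] by (simp only: l_def \<rho>_def)
    have eq: "avg ?\<Phi> h = avg (\<lambda>h. lyap w (hd h)) h + \<kappa> * avg (\<lambda>h. bonus h * rate w (hd h)) h"
      by (simp only: avg_add avg_cmult)
    have "avg (\<lambda>h. lyap w (hd h)) h + \<kappa> * avg (\<lambda>h. bonus h * rate w (hd h)) h + 1 / 1000000 * \<rho>
        \<le> l + \<kappa> * (bonus h * \<rho>)"
    proof (cases "d1 \<le> 2")
      case False
      then show ?thesis
        using rev fr r by (cases "fresh h") (auto simp: \<kappa>_def)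
    next
      case True
      have "avg (\<lambda>h. bonus h * rate w (hd h)) h \<le> 101 / 100 * \<rho> * avg bonus h"
        unfolding \<rho>_def by (intro avg_bonus_rate w)
      also have "\<dots> \<le> 101 / 100 * \<rho> * (if \<not> fresh h then 1 / 20 else 3 / 4 * bonus h)"
        using r by (intro mult_left_mono avg_bonus[OF h True]) auto
      finally have b: "avg (\<lambda>h. bonus h * rate w (hd h)) h
          \<le> 101 / 100 * \<rho> * (if \<not> fresh h then 1 / 20 else 3 / 4 * bonus h)" .
      show ?thesis
      proof (cases "fresh h")
        case False
        then have "bonus h = 0"
          by (simp add: bonus_def)
        then show ?thesis
          using rev[OF False] b r False True by (simp add: \<kappa>_def)
      next
        case f: True
        have "(1 / 40) * \<rho> \<le> bonus h * \<rho>"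
          using f r by (intro mult_right_mono) (auto simp: bonus_def)
        moreover have "avg (\<lambda>h. bonus h * rate w (hd h)) h \<le> 303 / 400 * (bonus h * \<rho>)"
          using b f by (simp add: mult.commute[of _ \<rho>])
        moreover have "avg (\<lambda>h. lyap w (hd h)) h \<le> l + 1 / 1000 * \<rho> * (1 / 400)"
          using fr[OF f] True by (simp only: if_True)
        ultimately show ?thesis
          using r True unfolding \<kappa>_def by (simp only: if_True)
      qed
    qed
    then show ?thesis
      unfolding eq by (simp only: l_def \<rho>_def)
  qed
  show "0 \<le> ?\<Phi> h" for h
    using bonus_bounds by (simp add: \<kappa>_def)
  show "0 \<le> ?g h" for h
    by simp
  show "0 < ?g [x]"
    using rate_pos[of w x] w by simp
  show "?g [x] \<le> ?g h" if "hd h = x" for h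
    using that by simp
qed

lemma summable_visits:
  assumes d: "4 \<le> d" "d < d1 + d2" "3 \<le> d2"
  shows "summable (\<lambda>n. measure (walk n) {h. hd h = x})"
proof -
  \<comment> \<open>With unit weights, a single fresh direction would give too large a positive
    drift at fresh sites. The case \<open>d1 = 1\<close> forces \<open>d2 = d\<close>, so at
    revisited sites at least three directions of weight 1 remain.\<close>
  define w :: "nat \<Rightarrow> real" where "w i = (if i = 1 \<and> d1 = 1 then 1 / 1000 else 1)" for i
  have w: "0 \<le> w i" "w i \<le> 1" for i
    by (simp_all add: w_def)
  show ?thesis
  proof (rule summable_visits_of_drift_bounds[OF w])
    fix h :: "(nat \<Rightarrow> int) list"
    have r: "0 \<le> 1 / 1000 * rate w (hd h)"
      by simp
    {
      assume h: "\<not> fresh h"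
      have "(2002 / 1000 * 1 - 999 / 1000 * (\<Sum>i\<in>dirs h. w i)) / card (dirs h) \<le> - 1 / 5"
      proof (cases "d1 = 1")
        case True
        then have "d2 = d"
          using d d2_le by auto
        then have all: "dirs h = {1..d}"
          unfolding dirs_def using h by simp
        have "(\<Sum>i\<in>{1..d} - {1}. 1) \<le> (\<Sum>i\<in>{1..d} - {1}. w i)"
          by (intro sum_mono) (auto simp: w_def)
        moreover have "(\<Sum>i\<in>{1..d}. w i) = w 1 + (\<Sum>i\<in>{1..d} - {1}. w i)"
          using d by (intro sum.remove) auto
        ultimately have "real d - 1 \<le> (\<Sum>i\<in>dirs h. w i)"
          using d w(1)[of 1] by (simp add: all of_nat_diff)
        moreover have "card (dirs h) = d"
          by (simp add: all)
        ultimately show ?thesis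
          using d by (simp only: divide_le_eq) simp
      next
        case False
        then have "(\<Sum>i\<in>dirs h. w i) = d2"
          using h by (simp add: w_def card_dirs)
        then show ?thesis
          using h d by (simp add: card_dirs divide_le_eq)
      qed
      from mult_left_mono[OF this r]
      show "avg (\<lambda>h. lyap w (hd h)) h \<le> lyap w (hd h) - 1 / 1000 * rate w (hd h) / 5"
        using avg_lyap[of w 1 h, OF w _ w(2)] by simp
    }
    assume h: "fresh h"
    define W :: real where "W = (if d1 = 1 then 1 / 1000 else 1)"
    have W0: "0 \<le> W" and W: "\<And>i. i \<in> dirs h \<Longrightarrow> w i \<le> W"
      using h by (auto simp: W_def w_def dirs_def)
    have "(\<Sum>i\<in>dirs h. w i) = W * d1"
    proof -
      have "(\<Sum>i\<in>dirs h. w i) = (\<Sum>i\<in>dirs h. W)"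
        using h by (intro sum.cong) (auto simp: W_def w_def dirs_def)
      then show ?thesis
        using h by (simp add: card_dirs)
    qed
    then have "(2002 / 1000 * W - 999 / 1000 * (\<Sum>i\<in>dirs h. w i)) / card (dirs h)
        \<le> (if d1 \<le> 2 then 1 / 400 else - 1 / 5)"
      using h d1_pos by (auto simp: W_def card_dirs divide_le_eq)
    from mult_left_mono[OF this r]
    show "avg (\<lambda>h. lyap w (hd h)) h
        \<le> lyap w (hd h) + 1 / 1000 * rate w (hd h) * (if d1 \<le> 2 then 1 / 400 else - 1 / 5)"
      using avg_lyap[of w W h, OF w W0 W] by linarith
  qed
qed

text \<open>The weighted coordinates are those that revisits never move, so \<open>lyap\<close> is
  constant at revisited sites. Since \<open>d - d2 < d1\<close>, all of them, at least three, are
  available at fresh sites, where the drift is strictly negative.\<close>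

lemma summable_fresh_visits:
  assumes d: "d < d1 + d2" "d2 + 3 \<le> d"
  shows "summable (\<lambda>n. measure (walk n) {h. fresh h \<and> (\<forall>i\<in>{1..d - d2}. hd h i = x i)})"
proof (rule summable_prob_of_drift)
  define w :: "nat \<Rightarrow> real" where "w i = (if i \<le> d - d2 then 1 else 0)" for i
  have w: "0 \<le> w i" "w i \<le> 1" for i
    by (simp_all add: w_def)
  let ?g = "\<lambda>h. if fresh h then 1 / 1000 * rate w (hd h) * (9 / 10 / d1) else 0"
  show "avg (\<lambda>h. lyap w (hd h)) h + ?g h \<le> lyap w (hd h)" for h
  proof (cases "fresh h")
    case True
    have "(\<Sum>i\<in>{1..d - d2}. 1) \<le> (\<Sum>i\<in>dirs h. w i)"
      using True d by (intro order_trans[OF _ sum_mono2[of "dirs h" "{1..d - d2}"]])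
        (auto simp: dirs_def w_def)
    then have "3 \<le> (\<Sum>i\<in>dirs h. w i)"
      using d by simp
    then have "(2002 / 1000 * 1 - 999 / 1000 * (\<Sum>i\<in>dirs h. w i)) / card (dirs h) \<le> - (9 / 10 / d1)"
      using d1_pos True by (simp add: card_dirs field_simps)
    from mult_left_mono[OF this, of "1 / 1000 * rate w (hd h)"] show ?thesis
      using avg_lyap[of w 1 h, OF w _ w(2)] True by simp
  next
    case False
    then have "(\<Sum>i\<in>dirs h. w i) = 0"
      using d by (intro sum.neutral) (auto simp: dirs_def w_def)
    then show ?thesis
      using avg_lyap[of w 0 h, OF w] False by (auto simp: dirs_def w_def)
  qed
  show "0 \<le> ?g h" for h
    by simp
  show "0 < 1 / 1000 * rate w x * (9 / 10 / d1)"
    using rate_pos[of w x] w d1_pos by simp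
  show "1 / 1000 * rate w x * (9 / 10 / d1) \<le> ?g h" if "fresh h \<and> (\<forall>i\<in>{1..d - d2}. hd h i = x i)" for h
  proof -
    have "pot w (hd h) = pot w x"
      unfolding pot_def using that by (auto intro!: sum.cong simp: w_def)
    then show ?thesis
      using that by simp
  qed
qed auto

text \<open>Coordinate \<open>d1\<close> is available at fresh and at revisited sites alike, so its
  square grows by at least \<open>1 / d\<close> per step on average, which cannot last within a
  bounded strip.\<close>

lemma summable_confined:
  assumes d: "d < d1 + d2"
  shows "summable (\<lambda>n. measure (walk n) {h. \<forall>y\<in>set h. \<bar>y d1\<bar> \<le> R})"
proof (rule summable_prob_of_drift)
  let ?conf = "\<lambda>h. \<forall>y\<in>set h. \<bar>y d1\<bar> \<le> R"
  \<comment> \<open>The step that leaves the strip may end at distance \<open>R + 1\<close>; with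
    \<open>R + 1\<close> in the square the quadratic function is still nonnegative there.\<close>
  let ?Z = "\<lambda>h. if ?conf h then real_of_int ((R + 1)\<^sup>2 - (hd h d1)\<^sup>2) else 0"
  let ?g = "\<lambda>h. if ?conf h then 1 / real d else 0"
  have sq: "0 \<le> (R + 1)\<^sup>2 - a\<^sup>2" if "\<bar>a\<bar> \<le> R + 1" for a
    using that by (simp add: abs_le_square_iff[symmetric])
  show "0 \<le> ?Z h" if "h \<in> set_pmf (walk n)" for n h
  proof -
    have "hd h \<in> set h"
      using walk_nonempty[OF that] by simp
    then show ?thesis
      using sq[of "hd h d1"] by (force simp del: of_int_diff)
  qed
  show "avg ?Z h + ?g h \<le> ?Z h" if h: "h \<in> set_pmf (walk n)" for n h
  proof (cases "?conf h")
    case True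
    define q where "q = real_of_int ((R + 1)\<^sup>2 - (hd h d1)\<^sup>2)"
    have "\<bar>hd h d1\<bar> \<le> R"
      using True walk_nonempty[OF h] by simp
    then have near: "\<bar>move (hd h) i s d1\<bar> \<le> R + 1" if "s \<in> {1, - 1}" for i s
      using that by (auto simp: move_apply)
    have "avg ?Z h \<le> avg (\<lambda>h. real_of_int ((R + 1)\<^sup>2 - (hd h d1)\<^sup>2)) h"
      using sq[OF near] by (intro avg_mono) (auto simp del: of_int_diff)
    also have "\<dots> = (\<Sum>i\<in>dirs h. 2 * q - (if i = d1 then 2 else 0)) / (2 * card (dirs h))"
      unfolding avg_def by (intro arg_cong2[where f = "(/)"] sum.cong)
        (auto simp: q_def move_apply power2_eq_square algebra_simps)
    also have "(\<Sum>i\<in>dirs h. 2 * q - (if i = d1 then 2 else 0)) = 2 * q * card (dirs h) - 2"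
      using d d1_pos d1_le d2_le by (auto simp: sum_subtractf dirs_def)
    also have "(2 * q * card (dirs h) - 2) / (2 * card (dirs h)) = q - 1 / card (dirs h)"
      using card_dirs_pos[of h] by (simp add: field_simps)
    also have "\<dots> \<le> q - 1 / d"
    proof -
      have "card (dirs h) \<le> d"
        using card_mono[OF _ dirs_subset[of h]] by simp
      then show ?thesis
        using card_dirs_pos[of h] by (intro diff_left_mono divide_left_mono) auto
    qed
    finally show ?thesis
      using True by (simp add: q_def)
  next
    case False
    then have "avg ?Z h \<le> avg (\<lambda>_. 0) h"
      by (intro avg_mono) auto
    then show ?thesis
      using False by (auto simp: avg_const)
  qed
  show "0 < 1 / real d"
    using d1_pos d1_le by simp
qed auto

end

section \<open>Transience outside the planar case\<close>

context balanced_excited_walk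
begin

lemma transient_of_eventually:
  assumes "\<And>x. x \<in> lattice d \<Longrightarrow> AE \<omega> in M. eventually (\<lambda>n. S n \<omega> \<noteq> x) sequentially"
  shows "transient M d S"
proof -
  have "AE \<omega> in M. \<forall>x\<in>lattice d. eventually (\<lambda>n. S n \<omega> \<noteq> x) sequentially"
    using countable_lattice assms by (subst AE_ball_countable) auto
  then show ?thesis
    unfolding transient_def
    by eventually_elim (auto simp: cofinite_eq_sequentially[symmetric] eventually_cofinite)
qed

lemma transient_of_d2_ge_3:
  assumes "4 \<le> d" "d < d1 + d2" "3 \<le> d2"
  shows "transient M d S"
  using AE_eventually_not[OF summable_visits[OF assms]] by (intro transient_of_eventually) simp

lemma transient_of_codim_ge_3:
  assumes d: "d < d1 + d2" "d2 + 3 \<le> d"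
  shows "transient M d S"
proof (rule transient_of_eventually)
  fix x assume "x \<in> lattice d"
  let ?same = "\<lambda>y. \<forall>i\<in>{1..d - d2}. y i = x i"
  have "AE \<omega> in M. eventually (\<lambda>n. \<not> (fresh (hist S n \<omega>) \<and> ?same (hd (hist S n \<omega>)))) sequentially"
    using AE_eventually_not[OF summable_fresh_visits[OF d, of x]] .
  moreover have "AE \<omega> in M. \<forall>R::nat. eventually (\<lambda>n. \<not> (\<forall>y\<in>set (hist S n \<omega>). \<bar>y d1\<bar> \<le> int R)) sequentially"
    unfolding AE_all_countable using AE_eventually_not[OF summable_confined[OF d(1)]] by blast
  ultimately show "AE \<omega> in M. eventually (\<lambda>n. S n \<omega> \<noteq> x) sequentially"
    using AE_hist_walk
  proof eventually_elim
    case (elim \<omega>)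
    obtain N where N: "\<And>n. N \<le> n \<Longrightarrow> ?same (S n \<omega>) \<Longrightarrow> \<not> fresh (hist S n \<omega>)"
      using elim(1) unfolding eventually_sequentially hd_hist by blast
    show ?case
    proof (rule ccontr)
      assume "\<not> ?case"
      then obtain n0 where n0: "N \<le> n0" "S n0 \<omega> = x"
        by (auto simp: eventually_sequentially)
      \<comment> \<open>After time \<open>N\<close> a site with this projection is not fresh, so the
        next step moves only the last \<open>d2\<close> coordinates and the projection
        persists.\<close>
      have same: "?same (S n \<omega>)" if "n0 \<le> n" for n
        using that
      proof (induction rule: dec_induct)
        case (step n)
        then have "\<not> fresh (hist S n \<omega>)"
          using N[of n] n0 by auto
        moreover obtain h i s where "i \<in> dirs h" "hist S (Suc n) \<omega> = move (hd h) i s # h"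
          using elim(3) by (meson walk_SucE)
        ultimately have "S (Suc n) \<omega> = move (S n \<omega>) i s" "i \<in> {d - d2 + 1..d}"
          by (auto simp: dirs_def)
        then show ?case
          using step.IH by auto
      qed (simp add: n0)
      \<comment> \<open>Without fresh times no new site is added to the history.\<close>
      have trapped: "set (hist S n \<omega>) \<subseteq> set (hist S n0 \<omega>)" if "n0 \<le> n" for n
        using that
      proof (induction rule: dec_induct)
        case (step n)
        have "\<not> fresh (hist S (Suc n) \<omega>)"
          using N[of "Suc n"] same[of "Suc n"] n0 step by auto
        then show ?case
          using step.IH by (auto simp: fresh_def)
      qed auto
      define R where "R = (\<Sum>y\<in>set (hist S n0 \<omega>). nat \<bar>y d1\<bar>)"
      have "\<bar>y d1\<bar> \<le> int R" if "n0 \<le> n" "y \<in> set (hist S n \<omega>)" for n y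
      proof -
        have "nat \<bar>y d1\<bar> \<le> R"
          unfolding R_def using trapped[OF that(1)] that(2) by (intro member_le_sum) auto
        then show ?thesis
          by linarith
      qed
      then show False
        using elim(2) unfolding eventually_sequentially by (meson nat_le_linear)
    qed
  qed
qed

end

section \<open>The planar Green function\<close>

text \<open>The transition probabilities of the simple random walk on the integers.\<close>

primrec kernel1 :: "nat \<Rightarrow> int \<Rightarrow> real" where
  "kernel1 0 u = (if u = 0 then 1 else 0)"
| "kernel1 (Suc t) u = (kernel1 t (u + 1) + kernel1 t (u - 1)) / 2"

lemma kernel1_nonneg: "0 \<le> kernel1 t u"
  by (induction t arbitrary: u) auto

lemma kernel1_binomial:
  "kernel1 t u = (if even (int t + u) \<and> \<bar>u\<bar> \<le> int t then real (t choose nat ((int t + u) div 2)) / 2 ^ t else 0)"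
proof (induction t arbitrary: u)
  case (Suc t)
  show ?case
  proof (cases "even (int (Suc t) + u) \<and> \<bar>u\<bar> \<le> int (Suc t)")
    case True
    then have ev: "even (int t + (u + 1))" "even (int t + (u - 1))"
      by presburger+
    obtain k where k: "int (Suc t) + u = 2 * k"
      using True by blast
    have k0: "0 \<le> k" "k \<le> int (Suc t)"
      using True k by auto
    have idx: "(int (Suc t) + u) div 2 = k" "(int t + (u + 1)) div 2 = k" "(int t + (u - 1)) div 2 = k - 1"
      using k by auto
    show ?thesis
    \<comment> \<open>At the left end point Pascal's rule has only one nonzero term, and
      \<open>k - 1\<close> would be negative.\<close>
    proof (cases "k = 0")
      case True
      then have "u = - int (Suc t)"
        using k by simp
      then show ?thesis
        using Suc[of "u + 1"] Suc[of "u - 1"] ev idx True by (simp add: field_simps)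
    next
      case False
      define m where "m = nat (k - 1)"
      have m: "k = int (Suc m)"
        using False k0 by (simp add: m_def)
      have u: "u = 2 * int (Suc m) - int (Suc t)"
        using k m by simp
      have mt: "m \<le> t"
        using m k0 by simp
      have "kernel1 t (u - 1) = real (t choose m) / 2 ^ t"
        using Suc[of "u - 1"] ev idx u mt m by (auto simp: nat_add_distrib)
      moreover have "kernel1 t (u + 1) = real (t choose Suc m) / 2 ^ t"
      proof (cases "m = t")
        case True
        then show ?thesis
          using Suc[of "u + 1"] u by simp
      next
        case False
        then show ?thesis
          using Suc[of "u + 1"] ev idx u mt m by (auto simp: nat_add_distrib)
      qed
      ultimately show ?thesis
        using \<open>even (int (Suc t) + u) \<and> \<bar>u\<bar> \<le> int (Suc t)\<close> idx
        by (simp add: m nat_add_distrib add_divide_distrib)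
    qed
  next
    case False
    have "kernel1 t (u + 1) = 0"
      using False Suc[of "u + 1"] by (auto simp: abs_le_iff)
    moreover have "kernel1 t (u - 1) = 0"
      using False Suc[of "u - 1"] by (auto simp: abs_le_iff)
    ultimately show ?thesis
      by (simp only: kernel1.simps False if_False) simp
  qed
qed auto

text \<open>The normalised central coefficient is multiplied by
  \<open>(2 * t + 1) / (2 * t + 2)\<close> in each step. Hence its square times
  \<open>2 * t + 1\<close> decreases from 1, while its square times \<open>4 * t\<close> increases
  from 1 at \<open>t = 1\<close>.\<close>

lemma central_sq_upper: "(real (2 * t choose t) / 4 ^ t)\<^sup>2 * (2 * t + 1) \<le> 1"
  and central_sq_lower: "0 < t \<Longrightarrow> 1 \<le> (real (2 * t choose t) / 4 ^ t)\<^sup>2 * (4 * t)"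
proof -
  define c where "c t = real (2 * t choose t) / 4 ^ t" for t
  have rec: "c (Suc t) = c t * ((2 * t + 1) / (2 * t + 2))" for t
  proof -
    have "Suc t * (Suc (2 * t) choose Suc t) = Suc (2 * t) * (2 * t choose t)"
      by (rule Suc_times_binomial)
    moreover have "(Suc (2 * t) choose t) = (Suc (2 * t) choose Suc t)"
      using binomial_symmetric[of t "Suc (2 * t)"] by (simp add: Suc_diff_le del: binomial_Suc_Suc)
    moreover have "(2 * Suc t choose Suc t) = (Suc (2 * t) choose t) + (Suc (2 * t) choose Suc t)"
      by simp
    ultimately have "Suc t * (2 * Suc t choose Suc t) = 2 * (2 * t + 1) * (2 * t choose t)"
      by (simp only: distrib_left) (simp add: algebra_simps del: binomial_Suc_Suc)
    then have "real (Suc t) * real (2 * Suc t choose Suc t) = 2 * (2 * t + 1) * real (2 * t choose t)"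
      by (metis of_nat_mult of_nat_numeral)
    then have "real (2 * Suc t choose Suc t) = 2 * (2 * t + 1) * real (2 * t choose t) / (t + 1)"
      by (simp only: nonzero_eq_divide_eq) (simp add: mult.commute del: binomial_Suc_Suc)
    moreover have "2 * (2 * y + 1) * z / (y + 1) / (4 * p) = z / p * ((2 * y + 1) / (2 * y + 2))"
      if "0 \<le> y" "0 < p" for y z p :: real
    proof -
      have "y + 1 \<noteq> 0" "2 * y + 2 = 2 * (y + 1)" "p \<noteq> 0"
        using that by auto
      then show ?thesis
        by (simp add: frac_eq_eq) (simp add: algebra_simps)
    qed
    from this[of "real t" "4 ^ t" "real (2 * t choose t)"]
    have "2 * (2 * real t + 1) * real (2 * t choose t) / (real t + 1) / 4 ^ Suc t
        = c t * ((2 * real t + 1) / (2 * real t + 2))"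
      by (simp add: c_def)
    ultimately show ?thesis
      unfolding c_def by (simp only: of_nat_add of_nat_mult of_nat_numeral of_nat_1)
  qed
  show "(real (2 * t choose t) / 4 ^ t)\<^sup>2 * (2 * t + 1) \<le> 1" for t
    unfolding c_def[symmetric]
  proof (induction t)
    case (Suc t)
    have "(2 * t + 1) * (2 * t + 3) / (2 * t + 2)\<^sup>2 \<le> (1::real)"
      by (simp add: divide_le_eq power2_eq_square algebra_simps not_less)
    from mult_left_mono[OF this, of "(c t)\<^sup>2 * (2 * t + 1)"]
    have "(c (Suc t))\<^sup>2 * (2 * Suc t + 1) \<le> (c t)\<^sup>2 * (2 * t + 1)"
      unfolding rec by (simp add: power2_eq_square field_simps)
    then show ?case
      using Suc by linarith
  qed (simp add: c_def)
  show "1 \<le> (real (2 * t choose t) / 4 ^ t)\<^sup>2 * (4 * t)" if "0 < t" for t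
    unfolding c_def[symmetric] using that
  proof (induction t rule: nat_induct_non_zero)
    case (Suc t)
    have "4 * real t \<le> (2 * real t + 1)\<^sup>2 / (real t + 1)"
      by (simp add: le_divide_eq power2_eq_square algebra_simps)
    then have "(c t)\<^sup>2 * (4 * t) \<le> (c t)\<^sup>2 * ((2 * real t + 1)\<^sup>2 / (real t + 1))"
      by (intro mult_left_mono) auto
    also have "\<dots> = (c (Suc t))\<^sup>2 * (4 * Suc t)"
    proof -
      have "p\<^sup>2 * (q\<^sup>2 / y) = (p * (q / (2 * y)))\<^sup>2 * (4 * y)" if "y > 0" for p q y :: real
        using that by (simp add: power2_eq_square field_simps)
      from this[of "real t + 1" "c t" "2 * real t + 1"] show ?thesis
        unfolding rec by (simp add: distrib_left add.commute)
    qed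
    finally show ?case
      using Suc by linarith
  qed (simp add: c_def power2_eq_square)
qed

lemma kernel1_even_le: "kernel1 (2 * t) u \<le> real (2 * t choose t) / 4 ^ t"
proof -
  have "real (2 * t choose k) / 2 ^ (2 * t) \<le> real (2 * t choose t) / 4 ^ t" for k
    using binomial_maximum'[of t k] by (simp add: power_mult divide_right_mono)
  then show ?thesis
    unfolding kernel1_binomial by (simp add: power_mult)
qed

lemma kernel1_even_0: "kernel1 (2 * t) 0 = real (2 * t choose t) / 4 ^ t"
  by (simp add: kernel1_binomial power_mult)

text \<open>In the rotated coordinates \<open>a + b\<close> and \<open>a - b\<close> the planar walk is a pair of independent
  one-dimensional walks.\<close>

definition kernel2 :: "nat \<Rightarrow> int \<Rightarrow> int \<Rightarrow> real" where
  "kernel2 t a b = kernel1 t (a + b) * kernel1 t (a - b)"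

lemma kernel2_nonneg: "0 \<le> kernel2 t a b"
  by (simp add: kernel2_def kernel1_nonneg)

lemma kernel2_0: "kernel2 0 a b = (if a = 0 \<and> b = 0 then 1 else 0)"
  by (auto simp: kernel2_def)

lemma kernel2_Suc:
  "kernel2 (Suc t) a b =
     (kernel2 t (a + 1) b + kernel2 t (a - 1) b + kernel2 t a (b + 1) + kernel2 t a (b - 1)) / 4"
  by (simp add: kernel2_def algebra_simps)

text \<open>At even times both factors are bounded by the central coefficient; at odd times the
  kernel is an average of four values at the preceding even time.\<close>

lemma kernel2_le: "kernel2 t a b \<le> 2 / (real t + 1)"
proof -
  have even: "kernel1 (2 * m) u * kernel1 (2 * m) v \<le> 1 / (2 * real m + 1)" for m u v
  proof -
    have "kernel1 (2 * m) u * kernel1 (2 * m) v \<le> (real (2 * m choose m) / 4 ^ m)\<^sup>2"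
      unfolding power2_eq_square by (intro mult_mono kernel1_even_le kernel1_nonneg) auto
    also have "\<dots> \<le> 1 / (2 * real m + 1)"
      using central_sq_upper[of m] by (simp add: le_divide_eq add.commute)
    finally show ?thesis .
  qed
  obtain m where "t = 2 * m \<or> t = Suc (2 * m)"
    by (metis even_two_times_div_two odd_two_times_div_two_succ Suc_eq_plus1)
  then show ?thesis
  proof
    assume t: "t = 2 * m"
    have "1 / (2 * real m + 1) \<le> 2 / (2 * real m + 1)"
      by (intro divide_right_mono) auto
    then show ?thesis
      using even[of m "a + b" "a - b"] by (simp add: kernel2_def t)
  next
    assume t: "t = Suc (2 * m)"
    let ?e = "1 / (2 * real m + 1)"
    have "kernel2 t a b \<le> (?e + ?e + ?e + ?e) / 4"
      unfolding t kernel2_Suc unfolding kernel2_def by (intro divide_right_mono add_mono even) auto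
    also have "\<dots> = 1 / (2 * real m + 1)"
      by (simp add: field_simps)
    also have "\<dots> \<le> 2 / (real t + 1)"
      by (simp add: t field_simps)
    finally show ?thesis .
  qed
qed

text \<open>The expected number of visits to the origin during the times \<open>m\<close> to
  \<open>T\<close> of a planar simple random walk that is at \<open>(a, b)\<close> at time
  \<open>s\<close>.\<close>

definition green :: "nat \<Rightarrow> nat \<Rightarrow> nat \<Rightarrow> int \<Rightarrow> int \<Rightarrow> real" where
  "green m T s a b = (\<Sum>t\<in>{max m s..T}. kernel2 (t - s) a b)"

lemma green_nonneg: "0 \<le> green m T s a b"
  by (simp add: green_def sum_nonneg kernel2_nonneg)

text \<open>First-step analysis: only the term for time \<open>s\<close> itself is lost, and it
  counts a visit exactly when the walk is at the origin within the window.\<close>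

lemma green_avg:
  "(green m T (Suc s) (a + 1) b + green m T (Suc s) (a - 1) b
    + green m T (Suc s) a (b + 1) + green m T (Suc s) a (b - 1)) / 4
   = green m T s a b - (if m \<le> s \<and> s \<le> T \<and> a = 0 \<and> b = 0 then 1 else 0)"
proof -
  have "(green m T (Suc s) (a + 1) b + green m T (Suc s) (a - 1) b
    + green m T (Suc s) a (b + 1) + green m T (Suc s) a (b - 1)) / 4
      = (\<Sum>t\<in>{max m (Suc s)..T}. kernel2 (Suc (t - Suc s)) a b)"
    unfolding green_def kernel2_Suc by (simp add: sum.distrib flip: sum_divide_distrib)
  also have "\<dots> = (\<Sum>t\<in>{max m (Suc s)..T}. kernel2 (t - s) a b)"
    by (intro sum.cong) (auto simp: Suc_diff_Suc)
  also have "\<dots> = green m T s a b - (if m \<le> s \<and> s \<le> T \<and> a = 0 \<and> b = 0 then 1 else 0)"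
  proof (cases "m \<le> s \<and> s \<le> T")
    case True
    then have "max m (Suc s) = Suc s" "max m s = s"
      by auto
    moreover have "{s..T} = insert s {Suc s..T}"
      using True by auto
    ultimately show ?thesis
      using True by (simp add: green_def kernel2_0)
  next
    case False
    then have "{max m (Suc s)..T} = {max m s..T}"
      by auto
    then show ?thesis
      using False by (auto simp: green_def)
  qed
  finally show ?thesis .
qed

lemma inverse_le_ln_diff: "1 / (real t + 1) \<le> ln (real t + 1) - ln (real t)" if "0 < t"
proof -
  have "ln (real t / (real t + 1)) \<le> real t / (real t + 1) - 1"
    using that by (intro ln_le_minus_one) auto
  also have "\<dots> = - (1 / (real t + 1))"
    by (simp add: field_simps)
  finally show ?thesis
    using that by (simp add: ln_div)
qed

lemma sum_inverse_le_ln: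
  assumes "0 < m" "m \<le> T"
  shows "(\<Sum>t\<in>{m..T}. 1 / (real t + 1)) \<le> ln (real T + 1) - ln (real m)"
proof -
  have "(\<Sum>t\<in>{m..T}. 1 / (real t + 1)) \<le> (\<Sum>t\<in>{m..T}. ln (real (Suc t)) - ln (real t))"
    using assms inverse_le_ln_diff by (intro sum_mono) (auto simp: add.commute)
  also have "\<dots> = ln (real T + 1) - ln (real m)"
    using assms by (subst sum_Suc_diff) (auto simp: add.commute)
  finally show ?thesis .
qed

lemma green_initial_le:
  assumes "0 < m" "m \<le> T"
  shows "green m T 0 a b \<le> 2 * (ln (real T + 1) - ln (real m))"
proof -
  have "green m T 0 a b \<le> (\<Sum>t\<in>{m..T}. 2 * (1 / (real t + 1)))"
    using kernel2_le by (auto simp: green_def intro!: sum_mono)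
  also have "\<dots> = 2 * (\<Sum>t\<in>{m..T}. 1 / (real t + 1))"
    by (simp only: sum_distrib_left)
  also have "\<dots> \<le> 2 * (ln (real T + 1) - ln (real m))"
    by (intro mult_left_mono sum_inverse_le_ln assms) auto
  finally show ?thesis .
qed

lemma green_le: "green 0 T s a b \<le> 2 + 2 * ln (real T + 1)"
proof -
  have "green 0 T s a b = (\<Sum>t\<in>{s..T}. kernel2 (t - s) a b)"
    by (simp add: green_def)
  also have "\<dots> \<le> (\<Sum>t\<in>{s..T}. 2 * (1 / (real (t - s) + 1)))"
  proof (intro sum_mono)
    show "kernel2 (t - s) a b \<le> 2 * (1 / (real (t - s) + 1))" for t
      using kernel2_le[of "t - s" a b] by simp
  qed
  also have "\<dots> \<le> (\<Sum>t\<in>{..T}. 2 * (1 / (real t + 1)))"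
  proof -
    have "(\<Sum>t\<in>{s..T}. 2 * (1 / (real (t - s) + 1))) = (\<Sum>j\<in>(\<lambda>t. t - s) ` {s..T}. 2 * (1 / (real j + 1)))"
      by (subst sum.reindex) (auto simp: inj_on_def)
    also have "\<dots> \<le> (\<Sum>t\<in>{..T}. 2 * (1 / (real t + 1)))"
      by (intro sum_mono2) auto
    finally show ?thesis .
  qed
  also have "\<dots> = 2 * (\<Sum>t\<in>{..T}. 1 / (real t + 1))"
    by (simp add: sum_distrib_left)
  also have "\<dots> \<le> 2 * (1 + ln (real T + 1))"
  proof (cases "T = 0")
    case False
    have "{..T} = insert 0 {1..T}"
      by auto
    then show ?thesis
      using sum_inverse_le_ln[of 1 T] False by simp
  qed simp
  finally show ?thesis
    by simp
qed

text \<open>Only even times are kept; there the return probability is at least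
  \<open>1 / (4 * t)\<close>, which leads to a harmonic sum.\<close>

lemma green_origin_ge: "ln (real N + 1) / 4 \<le> (\<Sum>j\<le>2 * N. kernel2 j 0 0)"
proof -
  have "ln (real N + 1) \<le> (\<Sum>t\<in>{1..N}. 1 / real t)"
  proof (induction N)
    case (Suc N)
    have "ln ((real N + 2) / (real N + 1)) \<le> (real N + 2) / (real N + 1) - 1"
      by (intro ln_le_minus_one) auto
    also have "\<dots> = 1 / (real N + 1)"
      by (simp add: field_simps)
    finally have "ln (real N + 2) - ln (real N + 1) \<le> 1 / (real N + 1)"
      by (simp add: ln_div)
    then show ?case
      using Suc by (simp add: add.commute)
  qed simp
  also have "\<dots> \<le> (\<Sum>t\<in>{1..N}. 4 * kernel2 (2 * t) 0 0)"
  proof (intro sum_mono)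
    fix t assume "t \<in> {1..N}"
    moreover have "kernel2 (2 * t) 0 0 = (real (2 * t choose t) / 4 ^ t)\<^sup>2"
      by (simp add: kernel2_def kernel1_even_0 power2_eq_square)
    ultimately show "1 / real t \<le> 4 * kernel2 (2 * t) 0 0"
      using central_sq_lower[of t] by (simp add: divide_le_eq mult_ac)
  qed
  also have "\<dots> = 4 * (\<Sum>j\<in>(\<lambda>t. 2 * t) ` {1..N}. kernel2 j 0 0)"
    by (subst sum.reindex) (auto simp: inj_on_def sum_distrib_left)
  also have "\<dots> \<le> 4 * (\<Sum>j\<le>2 * N. kernel2 j 0 0)"
    by (intro mult_left_mono sum_mono2) (auto simp: kernel2_nonneg)
  finally show ?thesis
    by simp
qed

text \<open>A walk at the origin at time \<open>s \<le> N\<close> still has at least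
  \<open>N\<close> steps before the horizon \<open>T\<close>.\<close>

lemma green_hit_ge:
  assumes "m \<le> s" "s \<le> N" "2 * N \<le> T"
  shows "(\<Sum>j\<le>N. kernel2 j 0 0) \<le> green m T s 0 0"
proof -
  have "(\<Sum>j\<le>N. kernel2 j 0 0) = (\<Sum>t\<in>{s..s + N}. kernel2 (t - s) 0 0)"
    by (rule sum.reindex_bij_witness[of _ "\<lambda>t. t - s" "\<lambda>j. j + s"]) auto
  also have "\<dots> \<le> (\<Sum>t\<in>{s..T}. kernel2 (t - s) 0 0)"
    using assms by (intro sum_mono2) (auto simp: kernel2_nonneg)
  finally show ?thesis
    using assms by (simp add: green_def max_def)
qed

section \<open>Two interleaved planar walks\<close>

text \<open>One scheme for all counters of steps: \<open>\<phi>\<close> sees the new site and the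
  history before the step. The initial site is not reached by a step and never counts.\<close>

primrec clock :: "('p \<Rightarrow> 'p list \<Rightarrow> bool) \<Rightarrow> 'p list \<Rightarrow> nat" where
  "clock \<phi> [] = 0"
| "clock \<phi> (x # h) = clock \<phi> h + (if h \<noteq> [] \<and> \<phi> x h then 1 else 0)"

abbreviation xclock :: "(nat \<Rightarrow> int) list \<Rightarrow> nat" where
  "xclock \<equiv> clock (\<lambda>x h. x 1 \<noteq> hd h 1 \<or> x 2 \<noteq> hd h 2)"

abbreviation yclock :: "(nat \<Rightarrow> int) list \<Rightarrow> nat" where
  "yclock \<equiv> clock (\<lambda>x h. x 3 \<noteq> hd h 3 \<or> x 4 \<noteq> hd h 4)"

abbreviation fresh_count :: "'p list \<Rightarrow> nat" where
  "fresh_count \<equiv> clock (\<lambda>x h. fresh h)"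

abbreviation revisits_over :: "int \<Rightarrow> int \<Rightarrow> (nat \<Rightarrow> int) list \<Rightarrow> nat" where
  "revisits_over a b \<equiv> clock (\<lambda>x h. \<not> fresh h \<and> hd h 3 = a \<and> hd h 4 = b)"

lemma clock_le: "clock \<phi> h \<le> length h - 1"
  by (induction h) (auto simp: neq_Nil_conv less_Suc_eq_le)

text \<open>Each site is fresh only at its first visit. The current site is excluded because no step
  has been made from it yet.\<close>

lemma fresh_count_eq_card: "fresh_count h = card (set (tl h))"
proof (induction h)
  case (Cons x h)
  show ?case
  proof (cases h)
    case (Cons y t)
    then have "set h = insert (hd h) (set (tl h))"
      by auto
    then show ?thesis
      using Cons.IH Cons by (auto simp: fresh_def card_insert_if insert_absorb)
  qed auto
qed auto

text \<open>All departures from \<open>z\<close> except the first are revisits, and each is counted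
  over the projection of \<open>z\<close> to the last two coordinates.\<close>

lemma count_visits_le:
  "count_list (tl h) z \<le> revisits_over (z 3) (z 4) h + (if z \<in> set (tl h) then 1 else 0)"
proof (induction h)
  case (Cons x h)
  show ?case
  proof (cases h)
    case (Cons y t)
    then show ?thesis
      using Cons.IH by (auto simp: fresh_def split: if_splits)
  qed auto
qed auto

lemma length_le_fresh_count:
  assumes "\<And>z. z \<in> set (tl h) \<Longrightarrow> revisits_over (z 3) (z 4) h < l"
  shows "length (tl h) \<le> fresh_count h * l"
proof -
  have "length (tl h) = (\<Sum>z\<in>set (tl h). count_list (tl h) z)"
    by (rule sum_count_set[symmetric]) auto
  also have "\<dots> \<le> (\<Sum>z\<in>set (tl h). l)"
    using count_visits_le[of h] assms by (intro sum_mono) (fastforce simp: Suc_le_eq intro: order_trans)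
  also have "\<dots> = fresh_count h * l"
    by (simp add: fresh_count_eq_card)
  finally show ?thesis .
qed

interpretation planar: excited_params 4 4 2
  by unfold_locales auto

lemma planar_avg_fresh:
  assumes "fresh h"
  shows "planar.avg \<Phi> h =
    (\<Phi> (move (hd h) 1 1 # h) + \<Phi> (move (hd h) 1 (- 1) # h) + \<Phi> (move (hd h) 2 1 # h) + \<Phi> (move (hd h) 2 (- 1) # h)
   + \<Phi> (move (hd h) 3 1 # h) + \<Phi> (move (hd h) 3 (- 1) # h) + \<Phi> (move (hd h) 4 1 # h) + \<Phi> (move (hd h) 4 (- 1) # h)) / 8"
proof -
  have "{1..4::nat} = {1, 2, 3, 4}"
    by auto
  then show ?thesis
    using assms by (simp add: planar.avg_def planar.dirs_def)
qed

lemma planar_avg_revisit: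
  assumes "\<not> fresh h"
  shows "planar.avg \<Phi> h =
    (\<Phi> (move (hd h) 3 1 # h) + \<Phi> (move (hd h) 3 (- 1) # h) + \<Phi> (move (hd h) 4 1 # h) + \<Phi> (move (hd h) 4 (- 1) # h)) / 4"
proof -
  have "{4 - 2 + 1..4::nat} = {3, 4}"
    by auto
  then show ?thesis
    using assms by (simp add: planar.avg_def planar.dirs_def)
qed

definition superharmonic :: "(nat \<Rightarrow> int \<Rightarrow> int \<Rightarrow> real) \<Rightarrow> bool" where
  "superharmonic U \<longleftrightarrow> (\<forall>s a b. 0 \<le> U s a b \<and>
     (U (Suc s) (a + 1) b + U (Suc s) (a - 1) b + U (Suc s) a (b + 1) + U (Suc s) a (b - 1)) / 4 \<le> U s a b)"

lemma superharmonicD: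
  assumes "superharmonic U"
  shows "0 \<le> U s a b"
    and "(U (Suc s) (a + 1) b + U (Suc s) (a - 1) b + U (Suc s) a (b + 1) + U (Suc s) a (b - 1)) / 4 \<le> U s a b"
  using assms unfolding superharmonic_def by blast+

text \<open>Each step advances only one of the two planar components, hence a product of superharmonic
  functions is a supermartingale; this replaces the independence of the two components.\<close>

lemma planar_avg_product:
  fixes x1 x2 y1 y2 :: int
  assumes U: "superharmonic U" and V: "superharmonic V" and h: "h \<noteq> []"
  defines "\<Phi> \<equiv> \<lambda>h. U (xclock h) (hd h 1 - x1) (hd h 2 - x2) * V (yclock h) (hd h 3 - y1) (hd h 4 - y2)"
  shows "planar.avg \<Phi> h \<le> \<Phi> h"
proof -
  define s t a b a' b' where "s = xclock h" "t = yclock h" "a = hd h 1 - x1" "b = hd h 2 - x2"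
    "a' = hd h 3 - y1" "b' = hd h 4 - y2"
  note defs = this
  define AU where "AU = (U (Suc s) (a + 1) b + U (Suc s) (a - 1) b + U (Suc s) a (b + 1) + U (Suc s) a (b - 1)) / 4"
  define AV where "AV = (V (Suc t) (a' + 1) b' + V (Suc t) (a' - 1) b' + V (Suc t) a' (b' + 1) + V (Suc t) a' (b' - 1)) / 4"
  have ineqs: "0 \<le> U s a b" "AU \<le> U s a b" "0 \<le> V t a' b'" "AV \<le> V t a' b'"
    unfolding AU_def AV_def using superharmonicD[OF U] superharmonicD[OF V] by simp_all
  have \<Phi>: "\<Phi> h = U s a b * V t a' b'"
    by (simp add: \<Phi>_def defs)
  have moves:
    "\<Phi> (move (hd h) 1 1 # h) = U (Suc s) (a + 1) b * V t a' b'"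
    "\<Phi> (move (hd h) 1 (- 1) # h) = U (Suc s) (a - 1) b * V t a' b'"
    "\<Phi> (move (hd h) 2 1 # h) = U (Suc s) a (b + 1) * V t a' b'"
    "\<Phi> (move (hd h) 2 (- 1) # h) = U (Suc s) a (b - 1) * V t a' b'"
    "\<Phi> (move (hd h) 3 1 # h) = U s a b * V (Suc t) (a' + 1) b'"
    "\<Phi> (move (hd h) 3 (- 1) # h) = U s a b * V (Suc t) (a' - 1) b'"
    "\<Phi> (move (hd h) 4 1 # h) = U s a b * V (Suc t) a' (b' + 1)"
    "\<Phi> (move (hd h) 4 (- 1) # h) = U s a b * V (Suc t) a' (b' - 1)"
    using h by (simp_all add: \<Phi>_def defs move_apply algebra_simps)
  show ?thesis
  proof (cases "fresh h")
    case True
    have "planar.avg \<Phi> h = (AU * V t a' b' + U s a b * AV) / 2"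
      unfolding planar_avg_fresh[OF True] moves AU_def AV_def by (simp add: field_simps)
    also have "\<dots> \<le> (U s a b * V t a' b' + U s a b * V t a' b') / 2"
      using ineqs by (intro divide_right_mono add_mono mult_left_mono mult_right_mono) auto
    finally show ?thesis
      by (simp add: \<Phi>)
  next
    case False
    have "planar.avg \<Phi> h = U s a b * AV"
      unfolding planar_avg_revisit[OF False] moves AV_def by (simp add: field_simps)
    also have "\<dots> \<le> U s a b * V t a' b'"
      using ineqs by (intro mult_left_mono) auto
    finally show ?thesis
      by (simp add: \<Phi>)
  qed
qed

lemma superharmonic_green: "superharmonic (green m T)"
  by (simp add: superharmonic_def green_nonneg green_avg)

lemma superharmonic_divide:
  assumes "superharmonic U" "0 < c"
  shows "superharmonic (\<lambda>s a b. U s a b / c)"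
  unfolding superharmonic_def
proof (intro allI conjI)
  fix s a b
  show "0 \<le> U s a b / c"
    using superharmonicD(1)[OF assms(1)] assms(2) by simp
  have "(U (Suc s) (a + 1) b + U (Suc s) (a - 1) b + U (Suc s) a (b + 1) + U (Suc s) a (b - 1)) / 4 / c \<le> U s a b / c"
    using assms(2) by (intro divide_right_mono superharmonicD(2)[OF assms(1)]) auto
  then show "(U (Suc s) (a + 1) b / c + U (Suc s) (a - 1) b / c + U (Suc s) a (b + 1) / c
      + U (Suc s) a (b - 1) / c) / 4 \<le> U s a b / c"
    by (simp add: add_divide_distrib)
qed

text \<open>An exponential moment of the local time: a revisit over the point multiplies the power
  by \<open>1 + 1 / G\<close>, but the Green function then drops by 1 on average, and
  \<open>(1 + 1 / G) * g \<le> 1 + g\<close> because \<open>g \<le> G\<close>.\<close>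

lemma planar_avg_local_time:
  fixes y1 y2 :: int
  assumes h: "h \<in> set_pmf (planar.walk m)" and m: "m \<le> T"
    and G: "0 < G" "\<And>s a b. green 0 T s a b \<le> G"
  defines "\<Phi> \<equiv> \<lambda>h. (1 + 1 / G) ^ revisits_over y1 y2 h * (1 + green 0 T (yclock h) (hd h 3 - y1) (hd h 4 - y2))"
  shows "planar.avg \<Phi> h \<le> \<Phi> h"
proof -
  have ne: "h \<noteq> []"
    using h by (rule planar.walk_nonempty)
  define r t a b where "r = (1 + 1 / G) ^ revisits_over y1 y2 h" "t = yclock h" "a = hd h 3 - y1" "b = hd h 4 - y2"
  note defs = this
  have r: "0 \<le> r"
    using G by (simp add: defs)
  have "t \<le> length h - 1"
    unfolding defs by (rule clock_le)
  \<comment> \<open>The drop by 1 occurs only while the clock has not passed the horizon.\<close>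
  then have tT: "t \<le> T"
    using planar.length_walk[OF h] m by simp
  define g where "g = green 0 T"
  define A where "A = (g (Suc t) (a + 1) b + g (Suc t) (a - 1) b + g (Suc t) a (b + 1) + g (Suc t) a (b - 1)) / 4"
  have A: "A = g t a b - (if a = 0 \<and> b = 0 then 1 else 0)"
    using green_avg[of 0 T t a b] tT by (simp add: A_def g_def)
  have \<Phi>: "\<Phi> h = r * (1 + g t a b)"
    by (simp add: \<Phi>_def defs g_def)
  show ?thesis
  proof (cases "fresh h")
    case True
    have moves:
      "\<Phi> (move (hd h) 1 1 # h) = r * (1 + g t a b)"
      "\<Phi> (move (hd h) 1 (- 1) # h) = r * (1 + g t a b)"
      "\<Phi> (move (hd h) 2 1 # h) = r * (1 + g t a b)"
      "\<Phi> (move (hd h) 2 (- 1) # h) = r * (1 + g t a b)"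
      "\<Phi> (move (hd h) 3 1 # h) = r * (1 + g (Suc t) (a + 1) b)"
      "\<Phi> (move (hd h) 3 (- 1) # h) = r * (1 + g (Suc t) (a - 1) b)"
      "\<Phi> (move (hd h) 4 1 # h) = r * (1 + g (Suc t) a (b + 1))"
      "\<Phi> (move (hd h) 4 (- 1) # h) = r * (1 + g (Suc t) a (b - 1))"
      using ne True by (simp_all add: \<Phi>_def defs move_apply g_def algebra_simps)
    have "planar.avg \<Phi> h = (r * (1 + g t a b) + r * (1 + A)) / 2"
      unfolding planar_avg_fresh[OF True] moves A_def by (simp add: field_simps)
    also have "r * (1 + A) \<le> r * (1 + g t a b)"
      using r by (intro mult_left_mono) (auto simp: A)
    finally show ?thesis
      by (simp add: \<Phi>)
  next
    case False
    define q where "q = (if a = 0 \<and> b = 0 then 1 + 1 / G else 1)"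
    have moves:
      "\<Phi> (move (hd h) 3 1 # h) = r * q * (1 + g (Suc t) (a + 1) b)"
      "\<Phi> (move (hd h) 3 (- 1) # h) = r * q * (1 + g (Suc t) (a - 1) b)"
      "\<Phi> (move (hd h) 4 1 # h) = r * q * (1 + g (Suc t) a (b + 1))"
      "\<Phi> (move (hd h) 4 (- 1) # h) = r * q * (1 + g (Suc t) a (b - 1))"
      using ne False by (simp_all add: \<Phi>_def defs move_apply g_def q_def algebra_simps)
    have "planar.avg \<Phi> h = r * (q * (1 + A))"
      unfolding planar_avg_revisit[OF False] moves A_def by (simp add: field_simps)
    also have "q * (1 + A) \<le> 1 + g t a b"
      using G(1) G(2)[of t a b]
      by (cases "a = 0 \<and> b = 0") (auto simp: q_def A g_def field_simps)
    then have "r * (q * (1 + A)) \<le> r * (1 + g t a b)"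
      using r by (rule mult_left_mono)
    finally show ?thesis
      by (simp add: \<Phi>)
  qed
qed

section \<open>Tail bounds for local times and clocks\<close>

lemma local_time_tail:
  assumes G: "0 < G" "\<And>s a b. green 0 n s a b \<le> G"
  shows "measure (planar.walk n) {h. l \<le> revisits_over y1 y2 h} \<le> (1 + G) / (1 + 1 / G) ^ l"
proof -
  let ?\<Phi> = "\<lambda>h. (1 + 1 / G) ^ revisits_over y1 y2 h * (1 + green 0 n (yclock h) (hd h 3 - y1) (hd h 4 - y2))"
  have "(1 + 1 / G) ^ l * measure (planar.walk n) {h. l \<le> revisits_over y1 y2 h} \<le> planar.expect n ?\<Phi>"
  proof (rule planar.prob_le_expect)
    show "(1 + 1 / G) ^ l \<le> ?\<Phi> h" if "l \<le> revisits_over y1 y2 h" for h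
    proof -
      have "(1 + 1 / G) ^ l * 1 \<le> ?\<Phi> h"
        using that G by (intro mult_mono power_increasing) (auto simp: green_nonneg)
      then show ?thesis
        by simp
    qed
  qed (use G in \<open>simp add: green_nonneg add_nonneg_nonneg\<close>)
  also have "\<dots> \<le> ?\<Phi> [\<lambda>_. 0]"
    using G by (intro planar.expect_le_initial planar_avg_local_time) auto
  also have "\<dots> \<le> 1 + G"
    using G by simp
  finally show ?thesis
    using G by (simp add: pos_le_divide_eq mult.commute add_pos_pos)
qed

text \<open>The bases are \<open>(3 / 4) ^ 4\<close> and \<open>2 / (1 + (3 / 4) ^ 4)\<close>: the assumption then says that \<open>\<phi>\<close> ticks
  with probability at least \<open>1 / 2\<close> whenever \<open>\<psi>\<close> does.\<close>

lemma clock_tail: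
  assumes step: "\<And>h. h \<noteq> [] \<Longrightarrow> planar.avg (\<lambda>h. (81 / 256) ^ clock \<phi> h * (512 / 337) ^ clock \<psi> h) h
      \<le> (81 / 256) ^ clock \<phi> h * (512 / 337) ^ clock \<psi> h"
  shows "measure (planar.walk n) {h. 4 * clock \<phi> h \<le> clock \<psi> h \<and> f \<le> real (clock \<psi> h)} \<le> (8 / 9) powr f"
proof -
  let ?\<Phi> = "\<lambda>h. (81 / 256 :: real) ^ clock \<phi> h * (512 / 337) ^ clock \<psi> h"
  have "(9 / 8) powr f * measure (planar.walk n) {h. 4 * clock \<phi> h \<le> clock \<psi> h \<and> f \<le> real (clock \<psi> h)}
      \<le> planar.expect n ?\<Phi>"
  proof (rule planar.prob_le_expect)
    show "(9 / 8) powr f \<le> ?\<Phi> h" if "4 * clock \<phi> h \<le> clock \<psi> h \<and> f \<le> real (clock \<psi> h)" for h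
    proof -
      have "(9 / 8) powr f \<le> (9 / 8) powr (real (clock \<psi> h))"
        using that by (intro powr_mono) auto
      also have "\<dots> = (9 / 8) ^ clock \<psi> h"
        by (simp add: powr_realpow)
      \<comment> \<open>The product of the two constants is 384/337, which exceeds 9/8.\<close>
      also have "\<dots> \<le> (3 / 4 * (512 / 337)) ^ clock \<psi> h"
        by (intro power_mono) auto
      also have "\<dots> = (3 / 4) ^ clock \<psi> h * (512 / 337) ^ clock \<psi> h"
        by (simp only: power_mult_distrib)
      also have "\<dots> \<le> (3 / 4) ^ (4 * clock \<phi> h) * (512 / 337) ^ clock \<psi> h"
        using that by (intro mult_right_mono power_decreasing) auto
      also have "(3 / 4 :: real) ^ (4 * clock \<phi> h) = (81 / 256) ^ clock \<phi> h"
        by (simp add: power_mult power4_eq_xxxx)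
      finally show ?thesis .
    qed
  qed simp
  also have "\<dots> \<le> ?\<Phi> [\<lambda>_. 0]"
    by (intro planar.expect_le_initial step planar.walk_nonempty)
  finally have "(9 / 8) powr f * measure (planar.walk n) {h. 4 * clock \<phi> h \<le> clock \<psi> h \<and> f \<le> real (clock \<psi> h)} \<le> 1"
    by simp
  then have "measure (planar.walk n) {h. 4 * clock \<phi> h \<le> clock \<psi> h \<and> f \<le> real (clock \<psi> h)} \<le> 1 / (9 / 8) powr f"
    by (simp add: pos_le_divide_eq mult.commute)
  also have "1 / (9 / 8) powr f = (8 / 9) powr f"
    using powr_divide[of 1 "9 / 8" f] by simp
  finally show ?thesis .
qed

text \<open>A step from a fresh site moves the first component with probability 1/2; a step from a
  revisited site advances neither clock.\<close>

lemma xclock_tail: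
  "measure (planar.walk n) {h. 4 * xclock h \<le> fresh_count h \<and> f \<le> real (fresh_count h)} \<le> (8 / 9) powr f"
proof (rule clock_tail)
  fix h :: "(nat \<Rightarrow> int) list" assume "h \<noteq> []"
  then show "planar.avg (\<lambda>h. (81 / 256) ^ xclock h * (512 / 337) ^ fresh_count h) h
      \<le> (81 / 256) ^ xclock h * (512 / 337) ^ fresh_count h"
    by (cases "fresh h") (simp_all add: planar_avg_fresh planar_avg_revisit move_apply)
qed

text \<open>Every step moves the second component with probability at least 1/2.\<close>

lemma yclock_tail:
  "measure (planar.walk n) {h. 4 * yclock h \<le> clock (\<lambda>_ _. True) h \<and> f \<le> real (clock (\<lambda>_ _. True) h)}
     \<le> (8 / 9) powr f"
proof (rule clock_tail)
  fix h :: "(nat \<Rightarrow> int) list" assume "h \<noteq> []"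
  then show "planar.avg (\<lambda>h. (81 / 256) ^ yclock h * (512 / 337) ^ clock (\<lambda>_ _. True) h) h
      \<le> (81 / 256) ^ yclock h * (512 / 337) ^ clock (\<lambda>_ _. True) h"
    by (cases "fresh h") (simp_all add: planar_avg_fresh planar_avg_revisit move_apply)
qed

lemma clock_True: "clock (\<lambda>_ _. True) h = length h - 1"
  by (induction h) (auto simp: Suc_diff_le Suc_leI)

lemma walk_coordinate_le:
  "h \<in> set_pmf (planar.walk n) \<Longrightarrow> z \<in> set h \<Longrightarrow> \<bar>z i\<bar> \<le> int n"
proof (induction n arbitrary: h z)
  case (Suc n)
  obtain g j s where g: "g \<in> set_pmf (planar.walk n)" "s \<in> {1, - 1}" "h = move (hd g) j s # g"
    using Suc.prems(1) by (meson planar.walk_SucE)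
  have "\<bar>y i\<bar> \<le> int n" if "y \<in> set g" for y
    using Suc.IH[OF g(1) that] .
  moreover have "hd g \<in> set g"
    using planar.walk_nonempty[OF g(1)] by simp
  ultimately show ?case
    using Suc.prems(2) g by (fastforce simp: move_apply)
qed simp

text \<open>Of the order of the squared logarithm of the time scale \<open>2 ^ k\<close>, hence an upper bound for the
  local times of the second planar walk up to that time, outside a summable sequence of events.\<close>

abbreviation level :: "nat \<Rightarrow> nat" where
  "level k \<equiv> (2 * k + 4) * (5 * k)"

text \<open>Multiplied out to avoid division. For positive \<open>k\<close> the negation places both
  clocks at or beyond \<open>xstart k\<close> and \<open>ystart k\<close>.\<close>

definition slow :: "nat \<Rightarrow> (nat \<Rightarrow> int) list \<Rightarrow> bool" where
  "slow k h \<longleftrightarrow> 4 * xclock h * level k \<le> 2 ^ k \<or> 4 * yclock h \<le> 2 ^ k"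

lemma green_le_level: "green 0 (2 ^ k) s a b \<le> 2 * real k + 4"
proof -
  have "ln ((2::real) ^ k + 1) \<le> ln (2 ^ Suc k)"
    by (subst ln_le_cancel_iff) (simp_all add: add_pos_pos)
  also have "\<dots> = real (Suc k) * ln 2"
    by (rule ln_realpow)
  also have "\<dots> \<le> real (Suc k) * 1"
    using ln_2_less_1 by (intro mult_left_mono) auto
  finally show ?thesis
    using green_le[of "2 ^ k" s a b] by simp
qed

text \<open>By Bernoulli's inequality \<open>2 * k + 4\<close> revisits already double the
  exponential weight. The power 5 leaves a summable bound after a union over all planar points
  within reach, of order \<open>(2 ^ k)\<^sup>2\<close>.\<close>

lemma local_time_tail_level:
  "measure (planar.walk (2 ^ k)) {h. level k \<le> revisits_over y1 y2 h} \<le> (2 * real k + 5) / (2 ^ k) ^ 5"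
proof -
  let ?G = "2 * real k + 4"
  have "1 + real (2 * k + 4) * (1 / ?G) \<le> (1 + 1 / ?G) ^ (2 * k + 4)"
    by (intro Bernoulli_inequality) (auto intro: order_trans[of _ 0])
  moreover have "real (2 * k + 4) * (1 / ?G) = 1"
    by simp
  ultimately have "2 \<le> (1 + 1 / ?G) ^ (2 * k + 4)"
    by linarith
  then have "2 ^ (5 * k) \<le> ((1 + 1 / ?G) ^ (2 * k + 4)) ^ (5 * k)"
    by (intro power_mono) auto
  then have pow: "(2 ^ k) ^ 5 \<le> (1 + 1 / ?G) ^ level k"
    by (simp only: power_mult[symmetric] mult.commute[of k 5])
  have "measure (planar.walk (2 ^ k)) {h. level k \<le> revisits_over y1 y2 h} \<le> (1 + ?G) / (1 + 1 / ?G) ^ level k"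
    using green_le_level[of k] by (intro local_time_tail) auto
  also have "\<dots> \<le> (1 + ?G) / (2 ^ k) ^ 5"
    by (intro divide_left_mono pow) (auto intro!: mult_pos_pos zero_less_power add_pos_pos)
  finally show ?thesis
    by (simp add: add.commute)
qed

text \<open>Three bad events suffice: a large local time at some planar point, few moves of the
  first component for the number of fresh steps, few moves of the second component. Outside the
  first event, counting visits site by site forces at least \<open>2 ^ k / level k\<close> fresh
  steps.\<close>

lemma prob_slow:
  assumes k: "0 < k"
  shows "measure (planar.walk (2 ^ k)) {h. slow k h} \<le>
    (2 * 2 ^ k + 1)\<^sup>2 * ((2 * real k + 5) / (2 ^ k) ^ 5)
      + (8 / 9) powr (2 ^ k / real (level k)) + (8 / 9) powr (2 ^ k)"
proof -
  let ?W = "planar.walk (2 ^ k)"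
  let ?I = "{- (2 ^ k)..2 ^ k :: int} \<times> {- (2 ^ k)..2 ^ k :: int}"
  let ?f = "2 ^ k / real (level k)"
  define A where "A = (\<Union>(a, b)\<in>?I. {h. level k \<le> revisits_over a b h})"
  define B where "B = {h :: (nat \<Rightarrow> int) list. 4 * xclock h \<le> fresh_count h \<and> ?f \<le> real (fresh_count h)}"
  define C where "C = {h. 4 * yclock h \<le> clock (\<lambda>_ _. True) h \<and> 2 ^ k \<le> real (clock (\<lambda>_ _. True) h)}"
  have "h \<in> A \<union> B \<union> C" if h: "h \<in> set_pmf ?W" "slow k h" for h
  proof (rule ccontr)
    assume not: "h \<notin> A \<union> B \<union> C"
    have len: "length h = Suc (2 ^ k)"
      by (rule planar.length_walk[OF h(1)])
    then have "clock (\<lambda>_ _. True) h = 2 ^ k"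
      by (simp add: clock_True)
    then have "2 ^ k < 4 * yclock h"
      using not by (auto simp: C_def)
    moreover have "length (tl h) \<le> fresh_count h * level k"
    proof (rule length_le_fresh_count)
      fix z assume "z \<in> set (tl h)"
      then have "z \<in> set h"
        by (cases h) auto
      then have "\<bar>z 3\<bar> \<le> 2 ^ k" "\<bar>z 4\<bar> \<le> 2 ^ k"
        using walk_coordinate_le[OF h(1)] by force+
      then have "(z 3, z 4) \<in> ?I"
        by auto
      then show "revisits_over (z 3) (z 4) h < level k"
        using not unfolding A_def by (auto simp: not_le)
    qed
    then have F: "2 ^ k \<le> fresh_count h * level k"
      by (simp add: len)
    then have "real (2 ^ k) \<le> real (fresh_count h * level k)"
      by (rule of_nat_mono)
    then have "?f \<le> real (fresh_count h)"
      using k by (simp add: divide_le_eq)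
    then have "fresh_count h < 4 * xclock h"
      using not by (auto simp: B_def)
    then have "fresh_count h * level k < 4 * xclock h * level k"
      using k by (intro mult_strict_right_mono) auto
    then have "2 ^ k < 4 * xclock h * level k"
      using F by linarith
    ultimately show False
      using h(2) by (simp add: slow_def)
  qed
  then have "measure ?W {h. slow k h} \<le> measure ?W (A \<union> B \<union> C)"
    by (intro measure_pmf.finite_measure_mono_AE AE_pmfI) auto
  also have "\<dots> \<le> measure ?W A + measure ?W B + measure ?W C"
    using measure_Un_le[of "A \<union> B" ?W C] measure_Un_le[of A ?W B] by simp
  also have "\<dots> \<le> (2 * 2 ^ k + 1)\<^sup>2 * ((2 * real k + 5) / (2 ^ k) ^ 5) + (8 / 9) powr ?f + (8 / 9) powr (2 ^ k)"
  proof (intro add_mono)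
    have "measure ?W A \<le> (\<Sum>p\<in>?I. measure ?W (case p of (a, b) \<Rightarrow> {h. level k \<le> revisits_over a b h}))"
      unfolding A_def by (rule measure_pmf.finite_measure_subadditive_finite) auto
    also have "\<dots> \<le> (\<Sum>p\<in>?I. (2 * real k + 5) / (2 ^ k) ^ 5)"
      by (rule sum_mono) (simp only: case_prod_unfold local_time_tail_level)
    also have "\<dots> = (2 * 2 ^ k + 1)\<^sup>2 * ((2 * real k + 5) / (2 ^ k) ^ 5)"
      by (simp add: card_cartesian_product power2_eq_square)
    finally show "measure ?W A \<le> (2 * 2 ^ k + 1)\<^sup>2 * ((2 * real k + 5) / (2 ^ k) ^ 5)" .
    show "measure ?W B \<le> (8 / 9) powr ?f"
      unfolding B_def by (rule xclock_tail)
    show "measure ?W C \<le> (8 / 9) powr (2 ^ k)"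
      unfolding C_def by (rule yclock_tail)
  qed
  finally show ?thesis .
qed

section \<open>Late visits on dyadic time scales\<close>

definition late_visit :: "nat \<Rightarrow> nat \<Rightarrow> (nat \<Rightarrow> int) \<Rightarrow> (nat \<Rightarrow> int) list \<Rightarrow> bool" where
  "late_visit m m' z h \<longleftrightarrow> hd h = z \<and> m \<le> xclock h \<and> m' \<le> yclock h"

lemma prob_late_visit:
  assumes n: "0 < n" and m: "0 < m" "m \<le> 4 * n" and m': "0 < m'" "m' \<le> 4 * n"
  shows "measure (planar.walk (2 * n)) {h. planar.occurred (late_visit m m' z) h} \<le>
    (8 * (ln (4 * real n + 1) - ln (real m)) / ln (real n + 1))
      * (8 * (ln (4 * real n + 1) - ln (real m')) / ln (real n + 1))"
proof -
  \<comment> \<open>Up to time \<open>2 * n\<close> a visit leaves at least \<open>2 * n\<close>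
    steps before the horizon \<open>4 * n\<close>. Division by \<open>c\<close> thus makes each
    Green function at least 1 at a late visit, as the maximal inequality requires.\<close>
  define c where "c = (\<Sum>j\<le>2 * n. kernel2 j 0 0)"
  have ln0: "0 < ln (real n + 1)"
    using n by simp
  have cln: "ln (real n + 1) / 4 \<le> c"
    unfolding c_def by (rule green_origin_ge)
  then have c: "0 < c"
    using ln0 by linarith
  define U where "U j s a b = green j (4 * n) s a b / c" for j s a b
  have U: "superharmonic (U j)" for j
    unfolding U_def using c by (intro superharmonic_divide superharmonic_green)
  have U0: "U j 0 a b \<le> 8 * (ln (4 * real n + 1) - ln (real j)) / ln (real n + 1)"
    if j: "0 < j" "j \<le> 4 * n" for j a b
  proof -
    have "ln (real j) \<le> ln (4 * real n + 1)"
      using j by (subst ln_le_cancel_iff) auto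
    then have "2 * (ln (4 * real n + 1) - ln (real j)) / c
        \<le> 2 * (ln (4 * real n + 1) - ln (real j)) / (ln (real n + 1) / 4)"
      using cln ln0 c by (intro divide_left_mono) auto
    moreover have "U j 0 a b \<le> 2 * (ln (4 * real n + 1) - ln (real j)) / c"
      using green_initial_le[OF j, of a b] c unfolding U_def by (intro divide_right_mono) auto
    ultimately show ?thesis
      by simp
  qed
  have hit: "1 \<le> U j s 0 0" if "j \<le> s" "s \<le> 2 * n" for j s
    using green_hit_ge[of j s "2 * n" "4 * n"] that c by (simp add: U_def c_def)
  let ?\<Phi> = "\<lambda>h. U m (xclock h) (hd h 1 - z 1) (hd h 2 - z 2) * U m' (yclock h) (hd h 3 - z 3) (hd h 4 - z 4)"
  have "measure (planar.walk (2 * n)) {h. planar.occurred (late_visit m m' z) h} \<le> ?\<Phi> [\<lambda>_. 0]"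
  proof (rule planar.maximal_inequality)
    show "planar.avg ?\<Phi> h \<le> ?\<Phi> h" if "h \<in> set_pmf (planar.walk j)" for j h
      by (rule planar_avg_product[OF U U planar.walk_nonempty[OF that]])
    show "0 \<le> ?\<Phi> h" for h
      using superharmonicD(1)[OF U] by simp
    show "1 \<le> ?\<Phi> h" if "j \<le> 2 * n" "h \<in> set_pmf (planar.walk j)" "late_visit m m' z h" for j h
    proof -
      have "length h - 1 \<le> 2 * n"
        using planar.length_walk[OF that(2)] that(1) by simp
      then have "xclock h \<le> 2 * n" "yclock h \<le> 2 * n"
        using clock_le order_trans by blast+
      then have "1 \<le> U m (xclock h) 0 0" "1 \<le> U m' (yclock h) 0 0"
        using that(3) by (auto simp: late_visit_def intro!: hit)
      from mult_mono[OF this] show ?thesis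
        using that(3) superharmonicD(1)[OF U] by (simp add: late_visit_def)
    qed
  qed
  also have "\<dots> = U m 0 (- z 1) (- z 2) * U m' 0 (- z 3) (- z 4)"
    by simp
  also have "\<dots> \<le> (8 * (ln (4 * real n + 1) - ln (real m)) / ln (real n + 1))
      * (8 * (ln (4 * real n + 1) - ln (real m')) / ln (real n + 1))"
  proof (rule mult_mono)
    show "U m 0 (- z 1) (- z 2) \<le> 8 * (ln (4 * real n + 1) - ln (real m)) / ln (real n + 1)"
      by (rule U0[OF m])
    show "U m' 0 (- z 3) (- z 4) \<le> 8 * (ln (4 * real n + 1) - ln (real m')) / ln (real n + 1)"
      by (rule U0[OF m'])
    show "0 \<le> U m' 0 (- z 3) (- z 4)"
      by (rule superharmonicD(1)[OF U])
    show "0 \<le> 8 * (ln (4 * real n + 1) - ln (real m)) / ln (real n + 1)"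
      by (rule order_trans[OF superharmonicD(1)[OF U] U0[OF m]])
  qed
  finally show ?thesis .
qed

text \<open>The slowest bound to be summed is of order \<open>ln k / k\<^sup>2\<close>; the exponent
  3/2 leaves room for the logarithm.\<close>

lemma summable_of_bigo:
  fixes a b :: "nat \<Rightarrow> real"
  assumes "\<And>k. 0 < k \<Longrightarrow> a k \<le> b k" "\<And>k. 0 \<le> a k" "b \<in> O(\<lambda>k. real k powr (- 3 / 2))"
  shows "summable a"
proof -
  have "a \<in> O(b)"
  proof (intro bigoI[where c = 1] eventually_sequentiallyI[where c = 1])
    fix k :: nat assume "1 \<le> k"
    then show "norm (a k) \<le> 1 * norm (b k)"
      using assms(1)[of k] assms(2)[of k] by simp
  qed
  then have "a \<in> O(\<lambda>k. real k powr (- 3 / 2))"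
    using assms(3) by (rule landau_o.big_trans)
  then show ?thesis
    by (rule summable_comparison_test_bigo[rotated]) (simp add: summable_real_powr_iff)
qed

lemma summable_slow: "summable (\<lambda>k. measure (planar.walk (2 ^ k)) {h. slow k h})"
proof (rule summable_of_bigo)
  show "(\<lambda>k. (2 * 2 ^ k + 1)\<^sup>2 * ((2 * real k + 5) / (2 ^ k) ^ 5)
      + (8 / 9) powr (2 ^ k / real (level k)) + (8 / 9) powr (2 ^ k)) \<in> O(\<lambda>k. real k powr (- 3 / 2))"
    unfolding of_nat_mult of_nat_add of_nat_numeral by real_asymp
qed (use prob_slow in auto)

abbreviation xstart :: "nat \<Rightarrow> nat" where
  "xstart k \<equiv> 2 ^ k div (4 * level k) + 1"

abbreviation ystart :: "nat \<Rightarrow> nat" where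
  "ystart k \<equiv> 2 ^ k div 4 + 1"

lemma summable_late_visit:
  "summable (\<lambda>k. measure (planar.walk (2 * 2 ^ k)) {h. planar.occurred (late_visit (xstart k) (ystart k) z) h})"
proof (rule summable_of_bigo)
  fix k :: nat assume k: "0 < k"
  let ?L = "ln (4 * (2::real) ^ k + 1)" and ?l = "ln ((2::real) ^ k + 1)"
  have div_le: "2 ^ k div j \<le> (2 ^ k :: nat)" for j
    by (rule div_le_dividend)
  have "1 \<le> (2::nat) ^ k"
    by simp
  then have le: "xstart k \<le> 4 * 2 ^ k" "ystart k \<le> 4 * 2 ^ k"
    using div_le[of "4 * level k"] div_le[of 4] by linarith+
  \<comment> \<open>Because of the added 1, the integer starting times dominate the real quotients
    in spite of rounding down.\<close>
  have ge: "2 ^ k / real j \<le> real (2 ^ k div j + 1)" if "0 < j" for j :: nat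
  proof -
    have "2 ^ k \<le> (2 ^ k div j + 1) * j"
      using dividend_less_times_div[OF that, of "2 ^ k"] by (simp add: mult.commute)
    then have "real (2 ^ k) \<le> real ((2 ^ k div j + 1) * j)"
      by (rule of_nat_mono)
    then show ?thesis
      using that by (simp only: of_nat_mult of_nat_power of_nat_numeral) (simp add: divide_le_eq)
  qed
  have lnx: "ln (2 ^ k / real (4 * level k)) \<le> ln (real (xstart k))"
    using ge[of "4 * level k"] k by (subst ln_le_cancel_iff) (auto intro!: divide_pos_pos mult_pos_pos add_pos_pos)
  have lny: "ln (2 ^ k / real 4) \<le> ln (real (ystart k))"
    using ge[of 4] k by (subst ln_le_cancel_iff) auto
  have l: "0 < ?l"
    by (simp add: add_pos_pos)
  have "ln (real (xstart k)) \<le> ?L" "ln (real (ystart k)) \<le> ?L"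
    using of_nat_mono[OF le(1), where ?'a = real] of_nat_mono[OF le(2), where ?'a = real]
    by (subst ln_le_cancel_iff; simp add: add_pos_pos)+
  then have "(8 * (?L - ln (real (xstart k))) / ?l) * (8 * (?L - ln (real (ystart k))) / ?l)
      \<le> (8 * (?L - ln (2 ^ k / real (4 * level k))) / ?l) * (8 * (?L - ln (2 ^ k / real 4)) / ?l)"
    using lnx lny l by (intro mult_mono divide_right_mono) auto
  moreover have "measure (planar.walk (2 * 2 ^ k)) {h. planar.occurred (late_visit (xstart k) (ystart k) z) h}
      \<le> (8 * (?L - ln (real (xstart k))) / ?l) * (8 * (?L - ln (real (ystart k))) / ?l)"
    using prob_late_visit[of "2 ^ k" "xstart k" "ystart k" z] le by simp
  ultimately show "measure (planar.walk (2 * 2 ^ k)) {h. planar.occurred (late_visit (xstart k) (ystart k) z) h}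
      \<le> (8 * (?L - ln (2 ^ k / real (4 * level k))) / ?l) * (8 * (?L - ln (2 ^ k / real 4)) / ?l)"
    by linarith
next
  show "(\<lambda>k. (8 * (ln (4 * (2::real) ^ k + 1) - ln (2 ^ k / real (4 * level k))) / ln ((2::real) ^ k + 1))
      * (8 * (ln (4 * (2::real) ^ k + 1) - ln (2 ^ k / real 4)) / ln ((2::real) ^ k + 1)))
      \<in> O(\<lambda>k. real k powr (- 3 / 2))"
    unfolding of_nat_mult of_nat_add of_nat_numeral by real_asymp
qed auto

lemma (in excited_params) occurred_hist: "occurred E (hist S n \<omega>) \<longleftrightarrow> (\<exists>j\<le>n. E (hist S j \<omega>))"
  by (induction n) (auto simp: le_Suc_eq)

lemma clock_hist_mono: "m \<le> n \<Longrightarrow> clock \<phi> (hist S m \<omega>) \<le> clock \<phi> (hist S n \<omega>)"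
  by (induction n rule: dec_induct) auto

lemma transient_planar:
  assumes "balanced_excited_walk M 4 4 2 S"
  shows "transient M 4 S"
proof -
  interpret W: balanced_excited_walk M 4 4 2 S
    by (rule assms)
  show ?thesis
  proof (rule W.transient_of_eventually)
    fix x assume "x \<in> lattice 4"
    have "AE \<omega> in M. eventually (\<lambda>k. \<not> slow k (hist S (2 ^ k) \<omega>)) sequentially"
      by (rule W.AE_eventually_not[OF summable_slow])
    moreover have "AE \<omega> in M. eventually (\<lambda>k. \<not> planar.occurred (late_visit (xstart k) (ystart k) x)
        (hist S (2 * 2 ^ k) \<omega>)) sequentially"
      by (rule W.AE_eventually_not[OF summable_late_visit])
    ultimately show "AE \<omega> in M. eventually (\<lambda>n. S n \<omega> \<noteq> x) sequentially"
    proof eventually_elim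
      case (elim \<omega>)
      then have "eventually (\<lambda>k. \<not> slow k (hist S (2 ^ k) \<omega>) \<and>
          \<not> planar.occurred (late_visit (xstart k) (ystart k) x) (hist S (2 * 2 ^ k) \<omega>)) sequentially"
        by (rule eventually_conj)
      then obtain K where K: "\<And>k. K \<le> k \<Longrightarrow> \<not> slow k (hist S (2 ^ k) \<omega>)"
        "\<And>k. K \<le> k \<Longrightarrow> \<not> planar.occurred (late_visit (xstart k) (ystart k) x) (hist S (2 * 2 ^ k) \<omega>)"
        unfolding eventually_sequentially by blast
      show ?case
      proof (rule eventually_sequentiallyI)
        fix n :: nat assume n: "2 ^ Suc K \<le> n"
        have n0: "1 \<le> n"
          using n le_trans[OF one_le_power] by (metis one_le_numeral)
        \<comment> \<open>The dyadic block of \<open>n\<close>: clock bounds at time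
          \<open>2 ^ k\<close> persist up to \<open>n\<close> by monotonicity, and \<open>n\<close>
          is within the horizon \<open>2 * 2 ^ k\<close>.\<close>
        obtain k where k: "2 ^ k \<le> n" "n < 2 ^ Suc k"
          using ex_power_ivl1[of 2 n] n0 by auto
        then have "2 ^ Suc K < (2::nat) ^ Suc k"
          using n by linarith
        then have Kk: "K \<le> k" "0 < k"
          by (simp_all only: power_strict_increasing_iff)
        show "S n \<omega> \<noteq> x"
        proof
          assume "S n \<omega> = x"
          have pos: "0 < 4 * level k"
            using Kk(2) by simp
          have "2 ^ k < 4 * xclock (hist S (2 ^ k) \<omega>) * level k" "2 ^ k < 4 * yclock (hist S (2 ^ k) \<omega>)"
            using K(1)[OF Kk(1)] by (auto simp: slow_def)
          then have "2 ^ k < xclock (hist S (2 ^ k) \<omega>) * (4 * level k)" "2 ^ k < yclock (hist S (2 ^ k) \<omega>) * 4"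
            by (simp_all add: algebra_simps)
          then have "2 ^ k div (4 * level k) < xclock (hist S (2 ^ k) \<omega>)" "2 ^ k div 4 < yclock (hist S (2 ^ k) \<omega>)"
            by (simp_all only: div_less_iff_less_mult[OF pos] div_less_iff_less_mult[OF zero_less_numeral])
          then have "xstart k \<le> xclock (hist S (2 ^ k) \<omega>)" "ystart k \<le> yclock (hist S (2 ^ k) \<omega>)"
            by linarith+
          then have "late_visit (xstart k) (ystart k) x (hist S n \<omega>)"
            unfolding late_visit_def using \<open>S n \<omega> = x\<close>
            by (intro conjI order_trans[OF _ clock_hist_mono[OF k(1)]]) simp_all
          then have "planar.occurred (late_visit (xstart k) (ystart k) x) (hist S (2 * 2 ^ k) \<omega>)"
            unfolding planar.occurred_hist using k(2) by (intro exI[of _ n]) auto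
          then show False
            using K(2)[OF Kk(1)] by simp
        qed
      qed
    qed
  qed
qed

theorem theorem1:
  fixes M :: "'a measure" and d d1 d2 :: nat and S :: "nat \<Rightarrow> 'a \<Rightarrow> nat \<Rightarrow> int"
  assumes "d \<ge> 4"
    and "1 \<le> d1" "d1 \<le> d" "1 \<le> d2" "d2 \<le> d"
    and "d1 + d2 > d"
    and "(d, d1, d2) \<noteq> (4, 3, 2)"
    and "balanced_excited_walk M d d1 d2 S"
  shows "transient M d S"
proof -
  interpret balanced_excited_walk M d d1 d2 S
    by fact
  \<comment> \<open>If the first two cases fail, then \<open>d \<le> d2 + 2 \<le> 4\<close>, so
    \<open>d = 4\<close> and \<open>d2 = 2\<close>. Then \<open>d1\<close> exceeds 2, and the
    excluded triple leaves only \<open>d1 = 4\<close>.\<close>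
  consider "3 \<le> d2" | "d2 + 3 \<le> d" | "d = 4" "d1 = 4" "d2 = 2"
    using assms by force
  then show ?thesis
  proof cases
    case 1
    then show ?thesis
      using assms by (intro transient_of_d2_ge_3) auto
  next
    case 2
    then show ?thesis
      using assms by (intro transient_of_codim_ge_3) auto
  next
    case 3
    then show ?thesis
      using assms(8) transient_planar by simp
  qed
qed

end
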